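(* Let $m\ge 2$ and $d\ge 1$ be integers, let $\Theta\subseteq\mathbb{R}^d$ be a semi-algebraic set, and let $\psi=(\psi_1,\dots,\psi_m)$ be a rational map from $\mathbb{R}^d$ to $\mathbb{R}^m$ that is well-defined on $\Theta$ and satisfies $\psi(\Theta)\subseteq\Delta$, where $\Delta=\{p\in\mathbb{R}^m : p_x>0 \text{ for } x=1,\dots,m,\ \sum_{x=1}^m p_x=1\}$. Consider the parametric statistical model for a discrete random variable with values in $\{1,\dots,m\}$ consisting of all distributions whose probability vector lies in $\psi(\Theta)$. Then this model is an algebraic exponential family. That is, as a subfamily of the regular exponential family $(P_\eta\mid\eta\in\mathbb{R}^{m-1})$ of all distributions on $\{1,\dots,m\}$ with positive probabilities, it is induced by a set $M\subseteq \mathbb{R}^{m-1}$ for which there exist an open set $\bar N\subseteq\mathbb{R}^{m-1}$, a diffeomorphism $g:\mathbb{R}^{m-1}\to\bar N$ and a semi-algebraic set $A\subseteq\mathbb{R}^{m-1}$ with $M=g^{-1}(A\cap\bar N)$.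
   Context: Semi-algebraic sets: a basic semi-algebraic set in $\mathbb{R}^n$ is a set of the form $\{\theta\in\mathbb{R}^n : f(\theta)>0\ \forall f\in F,\ h(\theta)=0\ \forall h\in H\}$, where $F$ is a finite (possibly empty) set of real polynomials and $H$ is an arbitrary (possibly empty) set of real polynomials in $n$ indeterminates. A semi-algebraic set is a finite union of basic semi-algebraic sets. Rational maps: a rational map $\psi$ from $\mathbb{R}^d$ to $\mathbb{R}^m$ is given by $\psi_i=f_i/g_i$ with $f_i,g_i\in\mathbb{R}[t_1,\dots,t_d]$, $i=1,\dots,m$. It is well-defined on $\Theta$ if $\Theta\subseteq D_\psi=\{a\in\mathbb{R}^d : \prod_i g_i(a)\ne 0\}$. A diffeomorphism is a smooth (infinitely differentiable) bijection between open sets with smooth inverse. Regular exponential family: given a $\sigma$-finite measure $\nu$ on a sample space $\mathcal{X}$ and a measurable map $T:\mathcal{X}\to\mathbb{R}^k$, let $N=\{\eta\in\mathbb{R}^k : \int e^{\eta^tT(x)}d\nu(x)<\infty\}$, $\phi(\eta)=\log\int e^{\eta^tT(x)}d\nu(x)$, and let $P_\eta$ have $\nu$-density $e^{\eta^tT(x)-\phi(\eta)}$ for $\eta\in N$. The family $(P_\eta\mid\eta\in N)$ is a regular exponential family of order $k$ if $N$ is open and the support of the measure $\nu\circ T^{-1}$ has affine dimension $k$. Algebraic exponential family: if $(P_\eta\mid \eta\in N)$ is a regular exponential family of order $k$, the subfamily $(P_\eta\mid\eta\in M)$ induced by $M\subseteq N$ is an algebraic exponential family if there exist an open set $\bar N\subseteq\mathbb{R}^k$,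 a diffeomorphism $g:N\to\bar N$ and a semi-algebraic set $A\subseteq\mathbb{R}^k$ such that $M=g^{-1}(A\cap\bar N)$. Discrete regular exponential family: take $\mathcal{X}=\{1,\dots,m\}$, $\nu$ counting measure, and $T(x)=(I_{\{1\}}(x),\dots,I_{\{m-1\}}(x))^t$. Then $N=\mathbb{R}^{m-1}$, and $P_\eta$ has probabilities $p_\eta(x)=e^{\eta_x}/(1+\sum_{y=1}^{m-1}e^{\eta_y})$ for $x\le m-1$ and $p_\eta(m)=1/(1+\sum_{y=1}^{m-1}e^{\eta_y})$. The map $\eta\mapsto p_\eta$ is a bijection from $\mathbb{R}^{m-1}$ onto $\Delta$, with $\eta_x=\log(p_x/p_m)$. The set $M$ associated with the model is $\{\eta : p_\eta\in\psi(\Theta)\}$. *)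

theory Defs
  imports "HOL-Probability.Probability"
begin

(* Polynomials are represented by their polynomial functions; over the reals the two
   notions coincide. *)

definition basic_semialgebraic :: "'a::euclidean_space set \<Rightarrow> bool" where
  "basic_semialgebraic S \<longleftrightarrow>
     (\<exists>F H. finite F \<and> (\<forall>f\<in>F. real_polynomial_function f) \<and> (\<forall>h\<in>H. real_polynomial_function h) \<and>
        S = {\<theta>. (\<forall>f\<in>F. f \<theta> > 0) \<and> (\<forall>h\<in>H. h \<theta> = 0)})"

definition semialgebraic :: "'a::euclidean_space set \<Rightarrow> bool" where
  "semialgebraic S \<longleftrightarrow> (\<exists>\<B>. finite \<B> \<and> (\<forall>B\<in>\<B>. basic_semialgebraic B) \<and> S = \<Union>\<B>)"

(* Vectors in R^m are extensional functions on {1..m}.  Since x / 0 = 0, the quotient map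
   is only meaningful on its domain. *)

definition rational_map ::
    "nat \<Rightarrow> (nat \<Rightarrow> 'a \<Rightarrow> real) \<Rightarrow> (nat \<Rightarrow> 'a \<Rightarrow> real) \<Rightarrow> 'a \<Rightarrow> nat \<Rightarrow> real" where
  "rational_map m f g a = (\<lambda>i\<in>{1..m}. f i a / g i a)"

definition rational_map_domain :: "nat \<Rightarrow> (nat \<Rightarrow> 'a \<Rightarrow> real) \<Rightarrow> 'a set" where
  "rational_map_domain m g = {a. (\<Prod>i\<in>{1..m}. g i a) \<noteq> 0}"

definition open_simplex :: "nat \<Rightarrow> (nat \<Rightarrow> real) set" where
  "open_simplex m = {p \<in> {1..m} \<rightarrow>\<^sub>E UNIV. (\<forall>x\<in>{1..m}. p x > 0) \<and> (\<Sum>x\<in>{1..m}. p x) = 1}"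

(* Only intended for open S: there C^n means that all iterated directional derivatives up
   to order n exist and are continuous, those of order below n being differentiable. *)

primrec C_on :: "nat \<Rightarrow> 'a::euclidean_space set \<Rightarrow> ('a \<Rightarrow> 'b::euclidean_space) \<Rightarrow> bool" where
  "C_on 0 S f \<longleftrightarrow> continuous_on S f"
| "C_on (Suc n) S f \<longleftrightarrow>
     (\<forall>x\<in>S. f differentiable (at x)) \<and> (\<forall>v. C_on n S (\<lambda>x. frechet_derivative f (at x) v))"

definition smooth_on :: "'a::euclidean_space set \<Rightarrow> ('a \<Rightarrow> 'b::euclidean_space) \<Rightarrow> bool" where
  "smooth_on S f \<longleftrightarrow> (\<forall>n. C_on n S f)"

definition diffeomorphism ::
    "'a::euclidean_space set \<Rightarrow> 'b::euclidean_space set \<Rightarrow> ('a \<Rightarrow> 'b) \<Rightarrow> bool" where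
  "diffeomorphism U V g \<longleftrightarrow>
     open U \<and> open V \<and> bij_betw g U V \<and> smooth_on U g \<and> smooth_on V (inv_into U g)"

definition measure_support :: "'a::topological_space measure \<Rightarrow> 'a set" where
  "measure_support \<mu> = {x. \<forall>U. open U \<and> x \<in> U \<longrightarrow> emeasure \<mu> U > 0}"

definition natural_parameters :: "'x measure \<Rightarrow> ('x \<Rightarrow> 'a::euclidean_space) \<Rightarrow> 'a set" where
  "natural_parameters \<nu> T = {\<eta>. (\<integral>\<^sup>+x. ennreal (exp (\<eta> \<bullet> T x)) \<partial>\<nu>) < \<infinity>}"

definition log_partition :: "'x measure \<Rightarrow> ('x \<Rightarrow> 'a::euclidean_space) \<Rightarrow> 'a \<Rightarrow> real" where
  "log_partition \<nu> T \<eta> = ln (\<integral>x. exp (\<eta> \<bullet> T x) \<partial>\<nu>)"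

definition exp_family :: "'x measure \<Rightarrow> ('x \<Rightarrow> 'a::euclidean_space) \<Rightarrow> 'a \<Rightarrow> 'x measure" where
  "exp_family \<nu> T \<eta> = density \<nu> (\<lambda>x. ennreal (exp (\<eta> \<bullet> T x - log_partition \<nu> T \<eta>)))"

(* The order of the family is DIM('a). *)

definition regular_exponential_family ::
    "'x measure \<Rightarrow> ('x \<Rightarrow> 'a::euclidean_space) \<Rightarrow> bool" where
  "regular_exponential_family \<nu> T \<longleftrightarrow>
     sigma_finite_measure \<nu> \<and> T \<in> borel_measurable \<nu> \<and>
     open (natural_parameters \<nu> T) \<and>
     aff_dim (measure_support (distr \<nu> borel T)) = int DIM('a)"

(* The subfamily of (P_eta) induced by M is algebraic. *)

definition algebraic_exponential_family ::
    "'x measure \<Rightarrow> ('x \<Rightarrow> 'a::euclidean_space) \<Rightarrow> 'a set \<Rightarrow> bool" where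
  "algebraic_exponential_family \<nu> T M \<longleftrightarrow>
     regular_exponential_family \<nu> T \<and> M \<subseteq> natural_parameters \<nu> T \<and>
     (\<exists>(N' :: 'a set) g A. open N' \<and> diffeomorphism (natural_parameters \<nu> T) N' g \<and>
        semialgebraic A \<and> M = {\<eta> \<in> natural_parameters \<nu> T. g \<eta> \<in> A \<inter> N'})"

definition prob_vector :: "nat \<Rightarrow> nat measure \<Rightarrow> nat \<Rightarrow> real" where
  "prob_vector m P = (\<lambda>x\<in>{1..m}. measure P {x})"

definition discrete_model :: "nat \<Rightarrow> (nat \<Rightarrow> real) set \<Rightarrow> nat measure set" where
  "discrete_model m Q =
     {P. prob_space P \<and> space P = {1..m} \<and> sets P = Pow {1..m} \<and> prob_vector m P \<in> Q}"

(* The coordinates of R^(m-1) are indexed by a finite type 'k; e numbers them by 1, ..., m-1. *)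

definition discrete_stat :: "('k::finite \<Rightarrow> nat) \<Rightarrow> nat \<Rightarrow> real ^ 'k" where
  "discrete_stat e x = (\<chi> i. indicator {e i} x)"

end

theory Submission
  imports Defs "HOL-Library.Function_Algebras"
begin

text \<open>
  Under the diffeomorphism \<open>g \<eta> = (exp \<eta>\<^sub>i)\<^sub>i\<close> onto the positive orthant, \<open>P\<^sub>\<eta>\<close> has probabilities
  proportional to the coordinates of \<open>g \<eta>\<close> and \<open>1\<close>. After clearing denominators, \<open>p\<^sub>\<eta> = \<psi> \<theta>\<close> becomes a
  system of polynomial equations in \<open>(g \<eta>, \<theta>)\<close>, so \<open>g M\<close> is the trace of the projection of a
  semi-algebraic set, which is semi-algebraic by the Tarski--Seidenberg theorem.

  Tarski--Seidenberg is proved with the idea of the Cohen--Hoermander algorithm, but without sign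
  tables: if finitely many polynomials in the parameter have the same signs at \<open>x\<close> and \<open>y\<close>, then some
  order isomorphism \<open>\<rho>\<close> between two finite sets of reals matches the signs of all \<open>P x\<close>, at the points
  of the first set and in the intervals between them, with those of the \<open>P y\<close>. This goes by
  induction on a degree bound: the signs of \<open>P\<close> at the roots of \<open>Q\<close> are those of an element of
  smaller degree in the ideal \<open>(P, Q)\<close>, and between the roots of its derivative \<open>P\<close> is monotone.
  Since infinitely many equations may define a basic semi-algebraic set, Hilbert's basis theorem is
  needed as well.
\<close>

section \<open>Matching the signs of finitely many real polynomials\<close>

text \<open>\<open>\<rho>\<close> pairs finitely many cut points on one line with cut points on
  another; \<open>t\<close> and \<open>u\<close> then occupy corresponding cells. Comparing signs of
  differences treats cut points and open intervals alike.\<close>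

definition same_side :: "(real \<times> real) set \<Rightarrow> real \<Rightarrow> real \<Rightarrow> bool" where
  "same_side \<rho> t u \<longleftrightarrow> (\<forall>(r, s)\<in>\<rho>. sgn (t - r) = sgn (u - s))"

text \<open>Since the sign can be zero, this makes \<open>\<rho>\<close> the graph of an order
  isomorphism between its two finite projections.\<close>

definition order_compatible :: "(real \<times> real) set \<Rightarrow> bool" where
  "order_compatible \<rho> \<longleftrightarrow> finite \<rho> \<and> (\<forall>(r, s)\<in>\<rho>. same_side \<rho> r s)"

text \<open>A pair \<open>(p, q)\<close> is meant to hold the values of one polynomial family at two
  parameters. The condition replaces equality of sign tables; it also forces each \<open>p\<close>
  to have constant sign on each cell, because all points of a cell match the same
  \<open>u\<close>.\<close>

definition sign_matching :: "(real \<times> real) set \<Rightarrow> (real poly \<times> real poly) set \<Rightarrow> bool" where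
  "sign_matching \<rho> W \<longleftrightarrow> order_compatible \<rho> \<and>
     (\<forall>(p, q)\<in>W. \<forall>t u. same_side \<rho> t u \<longrightarrow> sgn (poly p t) = sgn (poly q u))"

lemma same_sideD: "same_side \<rho> t u \<Longrightarrow> (r, s) \<in> \<rho> \<Longrightarrow> sgn (t - r) = sgn (u - s)"
  by (auto simp: same_side_def)

lemma same_side_less: "same_side \<rho> t u \<Longrightarrow> (r, s) \<in> \<rho> \<Longrightarrow> t < r \<longleftrightarrow> u < s"
  by (drule (1) same_sideD) (metis diff_less_0_iff_less sgn_less)

lemma same_side_greater: "same_side \<rho> t u \<Longrightarrow> (r, s) \<in> \<rho> \<Longrightarrow> r < t \<longleftrightarrow> s < u"
  by (drule (1) same_sideD) (metis diff_gt_0_iff_gt sgn_greater)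

lemma same_sideI:
  assumes "\<And>r s. (r, s) \<in> \<rho> \<Longrightarrow> t < r \<longleftrightarrow> u < s" "\<And>r s. (r, s) \<in> \<rho> \<Longrightarrow> r < t \<longleftrightarrow> s < u"
  shows "same_side \<rho> t u"
proof -
  have "sgn (t - r) = sgn (u - s)" if "(r, s) \<in> \<rho>" for r s
    using assms[OF that] by (cases t r rule: linorder_cases; cases u s rule: linorder_cases) auto
  then show ?thesis
    by (auto simp: same_side_def)
qed

lemma same_side_converse: "same_side (\<rho>\<inverse>) u t \<longleftrightarrow> same_side \<rho> t u"
  by (force simp: same_side_def)

lemma same_side_mono: "same_side \<rho> t u \<Longrightarrow> \<rho>' \<subseteq> \<rho> \<Longrightarrow> same_side \<rho>' t u"
  by (auto simp: same_side_def)

lemma order_compatible_converse: "order_compatible \<rho> \<Longrightarrow> order_compatible (\<rho>\<inverse>)"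
  by (auto simp: order_compatible_def same_side_converse)

lemma order_compatible_mono: "order_compatible \<rho> \<Longrightarrow> \<rho>' \<subseteq> \<rho> \<Longrightarrow> order_compatible \<rho>'"
  unfolding order_compatible_def by (blast intro: finite_subset same_side_mono)

lemma order_compatibleD: "order_compatible \<rho> \<Longrightarrow> (r, s) \<in> \<rho> \<Longrightarrow> same_side \<rho> r s"
  by (auto simp: order_compatible_def)

lemma sign_matchingD:
  "sign_matching \<rho> W \<Longrightarrow> (p, q) \<in> W \<Longrightarrow> same_side \<rho> t u \<Longrightarrow> sgn (poly p t) = sgn (poly q u)"
  by (auto simp: sign_matching_def)

lemma finite_sets_separated:
  fixes L U :: "real set"
  assumes "finite L" "finite U" "\<And>l u. l \<in> L \<Longrightarrow> u \<in> U \<Longrightarrow> l < u"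
  obtains x where "\<And>l. l \<in> L \<Longrightarrow> l < x" "\<And>u. u \<in> U \<Longrightarrow> x < u"
proof -
  have "\<exists>x. (\<forall>l\<in>L. l < x) \<and> (\<forall>u\<in>U. x < u)"
  proof (cases "L = {} \<or> U = {}")
    case True
    then show ?thesis
    proof
      assume "L = {}"
      then show ?thesis
        using Min_le[OF assms(2)] by (intro exI[of _ "Min U - 1"]) force
    next
      assume "U = {}"
      then show ?thesis
        using Max_ge[OF assms(1)] by (intro exI[of _ "Max L + 1"]) force
    qed
  next
    case False
    then have "Max L < Min U"
      using assms by auto
    then obtain x where "Max L < x" "x < Min U"
      using dense by blast
    then show ?thesis
      using assms False by (intro exI[of _ x]) auto
  qed
  then show thesis
    using that by blast
qed

text \<open>A cut point has its partner. Otherwise the partners of the cut points left of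
  \<open>t\<close> lie below those of the cut points right of \<open>t\<close>, and \<open>u\<close>
  is chosen strictly between. This later carries a witness from one parameter to another.\<close>

lemma same_side_exists:
  assumes "order_compatible \<rho>"
  obtains u where "same_side \<rho> t u"
proof (cases "t \<in> fst ` \<rho>")
  case True
  then show ?thesis
    using that order_compatibleD[OF assms] by force
next
  case False
  define L where "L = snd ` {(r, s) \<in> \<rho>. r < t}"
  define U where "U = snd ` {(r, s) \<in> \<rho>. t < r}"
  have fin: "finite \<rho>"
    using assms by (simp add: order_compatible_def)
  obtain u where u: "\<And>s. s \<in> L \<Longrightarrow> s < u" "\<And>s. s \<in> U \<Longrightarrow> u < s"
  proof (rule finite_sets_separated)
    show "finite L" "finite U"
      unfolding L_def U_def by (auto intro!: finite_imageI finite_subset[OF _ fin])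
    show "s < s'" if "s \<in> L" "s' \<in> U" for s s'
      using that same_side_less[OF order_compatibleD[OF assms]] unfolding L_def U_def
      by fastforce
  qed auto
  have "same_side \<rho> t u"
  proof (rule same_sideI)
    fix r s assume rs: "(r, s) \<in> \<rho>"
    then have "r \<noteq> t"
      using False by force
    then consider "r < t" "s < u" | "t < r" "u < s"
      using u rs by (cases "r < t") (force simp: L_def U_def)+
    then show "t < r \<longleftrightarrow> u < s" "r < t \<longleftrightarrow> s < u"
      by (cases; simp)+
  qed
  then show ?thesis
    using that by blast
qed

section \<open>Sign changes, behaviour at infinity and monotonicity of a single real
  polynomial\<close>

lemma poly_sgn_root:
  fixes p :: "real poly"
  assumes "sgn (poly p u) \<noteq> sgn (poly p v)" "u < v"
  obtains z where "u \<le> z" "z \<le> v" "poly p z = 0"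
proof -
  have "\<exists>z. u \<le> z \<and> z \<le> v \<and> poly p z = 0"
  proof (cases "poly p u = 0 \<or> poly p v = 0")
    case True
    then show ?thesis
      using less_imp_le[OF assms(2)] by blast
  next
    case False
    then have "poly p u * poly p v < 0"
      using assms(1) by (auto simp: sgn_if mult_less_0_iff split: if_splits)
    then show ?thesis
      using poly_IVT[OF assms(2)] by (meson less_imp_le)
  qed
  then show thesis
    using that by blast
qed

lemma poly_sgn_at_top:
  fixes p :: "real poly"
  assumes "p \<noteq> 0"
  shows "\<exists>B. \<forall>t\<ge>B. sgn (poly p t) = sgn (lead_coeff p)"
proof (cases "lead_coeff p > 0")
  case True
  then show ?thesis
    using poly_pinfty_gt_lc[of p] by (metis sgn_pos less_le_trans)
next
  case False
  then have "lead_coeff (- p) > 0"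
    using assms by (simp add: less_le)
  then obtain B where "\<forall>t\<ge>B. lead_coeff (- p) \<le> poly (- p) t"
    using poly_pinfty_gt_lc by blast
  with \<open>lead_coeff (- p) > 0\<close> have "\<forall>t\<ge>B. poly p t < 0"
    by (metis less_le_trans poly_minus neg_0_less_iff_less)
  then show ?thesis
    using False assms by (metis sgn_neg leading_coeff_0_iff linorder_neqE)
qed

lemma poly_sgn_at_bot:
  fixes p :: "real poly"
  assumes "p \<noteq> 0"
  shows "\<exists>B. \<forall>t\<le>B. sgn (poly p t) = sgn (lead_coeff p) * (- 1) ^ degree p"
proof -
  \<comment> \<open>Reflecting the argument reduces minus infinity to plus infinity; the power of -1
    is the effect of the reflection on the leading coefficient.\<close>
  define q where "q = pcompose p [:0, -1:]"
  have "q \<noteq> 0"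
    using assms by (simp add: q_def pcompose_eq_0_iff)
  moreover have "lead_coeff q = lead_coeff p * (- 1) ^ degree p"
    unfolding q_def by (subst lead_coeff_comp) auto
  ultimately obtain B where B: "\<forall>t\<ge>B. sgn (poly q t) = sgn (lead_coeff p * (- 1) ^ degree p)"
    using poly_sgn_at_top by metis
  have "sgn (poly p t) = sgn (lead_coeff p) * (- 1) ^ degree p" if "t \<le> - B" for t
    using B[rule_format, of "- t"] that by (simp add: q_def poly_pcompose sgn_mult power_sgn)
  then show ?thesis
    by blast
qed

text \<open>One radius serves both ends, and \<open>B > c\<close> allows it to be placed beyond all
  cut points already present.\<close>

lemma poly_sgn_outside:
  fixes p :: "real poly"
  assumes "p \<noteq> 0"
  obtains B where "B > c"
    "\<And>t. t \<ge> B \<Longrightarrow> sgn (poly p t) = sgn (lead_coeff p)"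
    "\<And>t. t \<le> - B \<Longrightarrow> sgn (poly p t) = sgn (lead_coeff p) * (- 1) ^ degree p"
proof -
  obtain B1 where B1: "\<forall>t\<ge>B1. sgn (poly p t) = sgn (lead_coeff p)"
    using poly_sgn_at_top[OF assms] by blast
  obtain B2 where B2: "\<forall>t\<le>B2. sgn (poly p t) = sgn (lead_coeff p) * (- 1) ^ degree p"
    using poly_sgn_at_bot[OF assms] by blast
  show thesis
    by (rule that[of "Max {c + 1, B1, - B2}"]) (use B1 B2 in auto)
qed

lemma poly_pderiv_pos_less:
  fixes p :: "real poly"
  assumes "a < b" "\<And>z. a < z \<Longrightarrow> z < b \<Longrightarrow> poly (pderiv p) z > 0"
  shows "poly p a < poly p b"
proof -
  obtain z where "a < z" "z < b" and z: "poly p b - poly p a = (b - a) * poly (pderiv p) z"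
    using poly_MVT[OF assms(1)] by blast
  then have "(b - a) * poly (pderiv p) z > 0"
    using assms by simp
  then show ?thesis
    using z by simp
qed

text \<open>Monotonicity moves the signs at \<open>t\<close> and \<open>u\<close> to the end points:
  \<open>p\<close> is positive at \<open>r2\<close>, hence so is \<open>q\<close> at
  \<open>s2\<close>; \<open>q\<close> is negative at \<open>s1\<close>, hence so is \<open>p\<close>
  at \<open>r1\<close>. The intermediate value theorem then gives roots on opposite sides of
  \<open>t\<close> and \<open>u\<close>, which is incompatible with \<open>t\<close> and
  \<open>u\<close> lying on the same side of this pair of roots unless they are the roots
  themselves.\<close>

lemma opposite_sign_roots:
  fixes p q :: "real poly"
  assumes ord: "r1 < t" "t < r2" "s1 < u" "u < s2"
    and sgns: "sgn (poly p r1) = sgn (poly q s1)" "sgn (poly p r2) = sgn (poly q s2)"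
    and p': "\<And>z. r1 < z \<Longrightarrow> z < r2 \<Longrightarrow> poly (pderiv p) z > 0"
    and q': "\<And>z. s1 < z \<Longrightarrow> z < s2 \<Longrightarrow> poly (pderiv q) z > 0"
    and tu: "poly p t \<ge> 0" "poly q u \<le> 0"
  obtains a b where "r1 < a" "a \<le> t" "u \<le> b" "b < s2" "poly p a = 0" "poly q b = 0"
proof -
  have "poly p t < poly p r2"
    using ord p' by (intro poly_pderiv_pos_less) auto
  then have "poly q s2 > 0"
    using sgns tu by (metis le_less_trans sgn_greater)
  moreover have "poly q s1 < poly q u"
    using ord q' by (intro poly_pderiv_pos_less) auto
  then have "poly p r1 < 0"
    using sgns tu by (metis less_le_trans sgn_less)
  ultimately obtain a b where "r1 < a \<and> a \<le> t \<and> poly p a = 0" "u \<le> b \<and> b < s2 \<and> poly q b = 0"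
    using poly_IVT_pos[of r1 t p] poly_IVT_pos[of u s2 q] ord tu by (force simp: le_less)
  then show thesis
    using that by blast
qed

section \<open>Refining a matching by the roots of one more polynomial\<close>

lemma sign_matching_converse:
  "sign_matching \<rho> W \<Longrightarrow> sign_matching (\<rho>\<inverse>) (W\<inverse>)"
  by (fastforce simp: sign_matching_def same_side_converse order_compatible_converse)

lemma sign_matching_mono:
  "sign_matching \<rho> W \<Longrightarrow> W' \<subseteq> W \<Longrightarrow> sign_matching \<rho> W'"
  by (fastforce simp: sign_matching_def)

text \<open>A root outside the cut points would lie in an open cell. The sign is constant there, so
  the polynomial would vanish on a whole ball around the root.\<close>

lemma poly_root_matched:
  assumes W: "sign_matching \<rho> W" "(p, q) \<in> W" and "p \<noteq> 0" "poly p t = 0"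
  shows "t \<in> fst ` \<rho>"
proof (rule ccontr)
  assume t: "t \<notin> fst ` \<rho>"
  have oc: "order_compatible \<rho>"
    using W by (simp add: sign_matching_def)
  then have "finite (fst ` \<rho>)"
    by (simp add: order_compatible_def)
  then have "open (- (fst ` \<rho>))"
    by (simp add: finite_imp_closed open_Compl)
  then obtain e where e: "e > 0" "ball t e \<subseteq> - (fst ` \<rho>)"
    using t by (meson ComplI open_contains_ball)
  obtain u where u: "same_side \<rho> t u"
    using same_side_exists[OF oc] .
  have "poly p t' = 0" if t': "t' \<in> ball t e" for t'
  proof -
    have "closed_segment t t' \<subseteq> ball t e"
      using e t' by (intro closed_segment_subset) auto
    then have *: "r \<notin> closed_segment t t'" if "(r, s) \<in> \<rho>" for r s
      using e that by force
    have "same_side \<rho> t' u"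
    proof (rule same_sideI)
      fix r s assume rs: "(r, s) \<in> \<rho>"
      have "t' < r \<longleftrightarrow> t < r" "r < t' \<longleftrightarrow> r < t"
        using *[OF rs] by (auto simp: closed_segment_eq_real_ivl split: if_splits)
      then show "t' < r \<longleftrightarrow> u < s" "r < t' \<longleftrightarrow> s < u"
        using same_side_less[OF u rs] same_side_greater[OF u rs] by auto
    qed
    then have "sgn (poly p t') = sgn (poly p t)"
      using sign_matchingD[OF W] u by simp
    then show ?thesis
      using assms by (simp add: sgn_zero_iff)
  qed
  then have "ball t e \<subseteq> {x. poly p x = 0}"
    by auto
  moreover have "infinite (ball t e)"
    using \<open>e > 0\<close> by (simp add: ball_eq_greaterThanLessThan infinite_Ioo)
  ultimately show False
    using poly_roots_finite[OF \<open>p \<noteq> 0\<close>] by (meson finite_subset)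
qed

text \<open>The end points are the nearest cut points on either side of \<open>t\<close>, with their
  partners; \<open>l\<close> and \<open>h\<close> ensure that both exist.\<close>

lemma same_side_bracket:
  assumes tu: "same_side \<rho> t u" and oc: "order_compatible \<rho>" and t: "t \<notin> fst ` \<rho>"
    and lower: "(l, l') \<in> \<rho>" "l < t" and upper: "(h, h') \<in> \<rho>" "t < h"
  obtains r1 s1 r2 s2 where
    "(r1, s1) \<in> \<rho>" "(r2, s2) \<in> \<rho>" "r1 < t" "t < r2" "s1 < u" "u < s2"
    "\<And>a. r1 < a \<Longrightarrow> a < r2 \<Longrightarrow> a \<notin> fst ` \<rho>"
    "\<And>a b. r1 < a \<Longrightarrow> a < r2 \<Longrightarrow> s1 < b \<Longrightarrow> b < s2 \<Longrightarrow> same_side \<rho> a b"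
proof -
  have fin: "finite \<rho>"
    using oc by (simp add: order_compatible_def)
  define R where "R = {r \<in> fst ` \<rho>. r < t}"
  define S where "S = {r \<in> fst ` \<rho>. t < r}"
  have R: "finite R" "R \<noteq> {}" and S: "finite S" "S \<noteq> {}"
    using fin lower upper by (force simp: R_def S_def)+
  obtain s1 where s1: "(Max R, s1) \<in> \<rho>" "Max R < t"
    using Max_in[OF R] by (force simp: R_def)
  obtain s2 where s2: "(Min S, s2) \<in> \<rho>" "t < Min S"
    using Min_in[OF S] by (force simp: S_def)
  have s1u: "s1 < u" and us2: "u < s2"
    using same_side_greater[OF tu s1(1)] same_side_less[OF tu s2(1)] s1 s2 by auto
  have outside: "(r \<le> Max R \<and> s \<le> s1) \<or> (Min S \<le> r \<and> s2 \<le> s)" if rs: "(r, s) \<in> \<rho>" for r s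
  proof -
    have "r < t \<or> t < r"
      using t rs by force
    then have "r \<le> Max R \<or> Min S \<le> r"
      using rs R S by (force simp: R_def S_def intro!: Max_ge Min_le)
    then show ?thesis
      using same_side_greater[OF order_compatibleD[OF oc s1(1)] rs]
        same_side_less[OF order_compatibleD[OF oc s1(1)] rs]
        same_side_greater[OF order_compatibleD[OF oc s2(1)] rs]
        same_side_less[OF order_compatibleD[OF oc s2(1)] rs] by auto
  qed
  show thesis
  proof (rule that[OF s1(1) s2(1) s1(2) s2(2) s1u us2])
    show "a \<notin> fst ` \<rho>" if "Max R < a" "a < Min S" for a
      using outside that by force
    show "same_side \<rho> a b" if "Max R < a" "a < Min S" "s1 < b" "b < s2" for a b
    proof (rule same_sideI)
      fix r s assume rs: "(r, s) \<in> \<rho>"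
      show "a < r \<longleftrightarrow> b < s" "r < a \<longleftrightarrow> s < b"
        using outside[OF rs] that by auto
    qed
  qed
qed

text \<open>On the two matched intervals both derivatives have one and the same nonzero sign. If it
  is negative, \<open>opposite_sign_roots\<close> is applied to \<open>- q\<close> and
  \<open>- p\<close>, since negation exchanges the roles of the two polynomials; this accounts for
  the two alternatives at the end.\<close>

lemma monotone_roots:
  fixes p q :: "real poly"
  assumes ord: "r1 < t" "t < r2" "s1 < u" "u < s2"
    and sgns: "sgn (poly p r1) = sgn (poly q s1)" "sgn (poly p r2) = sgn (poly q s2)"
    and eq: "\<And>z w. r1 < z \<Longrightarrow> z < r2 \<Longrightarrow> s1 < w \<Longrightarrow> w < s2 \<Longrightarrow>
      sgn (poly (pderiv p) z) = sgn (poly (pderiv q) w)"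
    and nz: "poly (pderiv p) t \<noteq> 0"
    and tu: "poly p t \<ge> 0" "poly q u \<le> 0"
  obtains a b where "r1 < a" "a < r2" "s1 < b" "b < s2" "poly p a = 0" "poly q b = 0"
    "(a \<le> t \<and> u \<le> b) \<or> (t \<le> a \<and> b \<le> u)"
proof -
  have same: "sgn (poly (pderiv p) z) = sgn (poly (pderiv p) t)" if "r1 < z" "z < r2" for z
    using eq[of z u] eq[of t u] that ord by simp
  have same': "sgn (poly (pderiv q) z) = sgn (poly (pderiv p) t)" if "s1 < z" "z < s2" for z
    using eq[of t z] that ord by simp
  show thesis
  proof (cases "poly (pderiv p) t > 0")
    case True
    then have "poly (pderiv p) z > 0" if "r1 < z" "z < r2" for z
      using same[OF that] by (metis sgn_greater)
    moreover have "poly (pderiv q) z > 0" if "s1 < z" "z < s2" for z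
      using same'[OF that] True by (metis sgn_greater)
    ultimately obtain a b where "r1 < a" "a \<le> t" "u \<le> b" "b < s2" "poly p a = 0" "poly q b = 0"
      using opposite_sign_roots[OF ord sgns _ _ tu] by blast
    then show thesis
      using ord by (intro that[of a b]) auto
  next
    case False
    then have neg: "poly (pderiv p) t < 0"
      using nz by simp
    then have "poly (pderiv (- p)) z > 0" if "r1 < z" "z < r2" for z
      using same[OF that] by (simp add: pderiv_minus sgn_1_neg)
    moreover have "poly (pderiv (- q)) z > 0" if "s1 < z" "z < s2" for z
      using same'[OF that] neg by (simp add: pderiv_minus sgn_1_neg)
    moreover have "sgn (poly (- q) s1) = sgn (poly (- p) r1)" "sgn (poly (- q) s2) = sgn (poly (- p) r2)"
      using sgns by (simp_all add: sgn_minus)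
    moreover have "poly (- q) u \<ge> 0" "poly (- p) t \<le> 0"
      using tu by simp_all
    ultimately obtain b a where
      "s1 < b" "b \<le> u" "t \<le> a" "a < r2" "poly (- q) b = 0" "poly (- p) a = 0"
      using opposite_sign_roots[of s1 u s2 r1 t r2 "- q" "- p"] ord by blast
    then show thesis
      using ord by (intro that[of a b]) auto
  qed
qed

text \<open>Once the roots of the derivatives are cut points, \<open>p\<close> and \<open>q\<close>
  are strictly monotone on each interval, so an interval contains at most one root of each, and the
  signs at its ends decide whether it does. Assumption \<open>root\<close> gives these signs at the
  old cut points, the leading coefficients and degrees give them near infinity. Adding the matched
  roots as cut points then fixes all signs of \<open>p\<close> and \<open>q\<close>.\<close>

lemma sign_matching_insert:
  assumes W: "sign_matching \<rho> W" and p': "(pderiv p, pderiv q) \<in> W"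
    and zero: "\<And>a b. (a, b) \<in> W \<Longrightarrow> a = 0 \<longleftrightarrow> b = 0"
    and deg: "degree p = degree q" "degree p > 0" and lc: "sgn (lead_coeff p) = sgn (lead_coeff q)"
    and root: "\<And>a b t u. (a, b) \<in> W \<Longrightarrow> a \<noteq> 0 \<Longrightarrow> same_side \<rho> t u \<Longrightarrow> poly a t = 0 \<Longrightarrow>
      sgn (poly p t) = sgn (poly q u)"
  shows "\<exists>\<rho>'. sign_matching \<rho>' (insert (p, q) W)"
proof -
  have oc: "order_compatible \<rho>"
    using W by (simp add: sign_matching_def)
  have fin: "finite \<rho>"
    using oc by (simp add: order_compatible_def)
  have pq0: "p \<noteq> 0" "q \<noteq> 0" "pderiv p \<noteq> 0" "pderiv q \<noteq> 0"
    using deg by (auto simp: pderiv_eq_0_iff)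
  \<comment> \<open>The sign of \<open>p\<close> is only known at roots of members of \<open>W\<close>, so all other points are discarded.\<close>
  define \<rho>0 where "\<rho>0 = {(r, s) \<in> \<rho>. \<exists>(a, b)\<in>W. a \<noteq> 0 \<and> poly a r = 0}"
  have sub: "\<rho>0 \<subseteq> \<rho>"
    by (auto simp: \<rho>0_def)
  have oc0: "order_compatible \<rho>0"
    by (rule order_compatible_mono[OF oc sub])
  have root1: "\<exists>s. (t, s) \<in> \<rho>0" if ab: "(a, b) \<in> W" "a \<noteq> 0" "poly a t = 0" for a b t
    using poly_root_matched[OF W ab] ab by (fastforce simp: \<rho>0_def)
  \<comment> \<open>\<open>\<rho>0\<close> selects by roots of first components, so a root of
    \<open>b\<close> is matched through the converse relation and then seen to be paired with a root
    of \<open>a\<close>.\<close>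
  have root2: "\<exists>r. (r, u) \<in> \<rho>0" if ab: "(a, b) \<in> W" "b \<noteq> 0" "poly b u = 0" for a b u
  proof -
    have "u \<in> fst ` (\<rho>\<inverse>)"
      using poly_root_matched[OF sign_matching_converse[OF W], of b a u] ab by simp
    then obtain r where r: "(r, u) \<in> \<rho>"
      by force
    then have "poly a r = 0"
      using sign_matchingD[OF W ab(1) order_compatibleD[OF oc r]] ab by (simp add: sgn_zero_iff)
    then show ?thesis
      using r ab zero[OF ab(1)] by (fastforce simp: \<rho>0_def)
  qed
  \<comment> \<open>Dropping cut points does no harm to \<open>W\<close>. If \<open>b\<close>
    changed sign between \<open>u\<close> and the point \<open>u'\<close> matched to
    \<open>t\<close> under all of \<open>\<rho>\<close>, it would have a root between them; that
    root is still in \<open>\<rho>0\<close> and would separate them.\<close>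
  have match0: "sgn (poly a t) = sgn (poly b u)" if ab: "(a, b) \<in> W" and tu: "same_side \<rho>0 t u" for a b t u
  proof (cases "b = 0")
    case True
    then show ?thesis
      using zero[OF ab] by simp
  next
    case False
    obtain u' where u': "same_side \<rho> t u'"
      using same_side_exists[OF oc] .
    have "sgn (poly a t) = sgn (poly b u')"
      by (rule sign_matchingD[OF W ab u'])
    moreover have "sgn (poly b u) = sgn (poly b u')"
    proof (rule ccontr)
      assume ne: "sgn (poly b u) \<noteq> sgn (poly b u')"
      then have "u < u' \<or> u' < u"
        by (metis linorder_neqE)
      then obtain z where z: "poly b z = 0" "u < u' \<Longrightarrow> u \<le> z \<and> z \<le> u'" "u' < u \<Longrightarrow> u' \<le> z \<and> z \<le> u"
        using ne poly_sgn_root[of b u u'] poly_sgn_root[of b u' u] by (metis less_asym)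
      then obtain r where r: "(r, z) \<in> \<rho>0"
        using root2 ab False by blast
      have "sgn (u - z) = sgn (u' - z)"
        using same_sideD[OF tu r] same_sideD[OF same_side_mono[OF u' sub] r] by simp
      then show False
        using z \<open>u < u' \<or> u' < u\<close> by (auto simp: sgn_if split: if_splits)
    qed
    ultimately show ?thesis
      by simp
  qed
  have endp0: "sgn (poly p r) = sgn (poly q s)" if "(r, s) \<in> \<rho>0" for r s
    using that root order_compatibleD[OF oc] by (force simp: \<rho>0_def)
  have fin0: "finite \<rho>0"
    using sub fin by (rule finite_subset)
  obtain B where B: "B > Max (insert 0 ((\<lambda>(r, s). \<bar>r\<bar>) ` \<rho>0))"
    "\<And>t. t \<ge> B \<Longrightarrow> sgn (poly p t) = sgn (lead_coeff p)"
    "\<And>t. t \<le> - B \<Longrightarrow> sgn (poly p t) = sgn (lead_coeff p) * (- 1) ^ degree p"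
    using poly_sgn_outside[OF pq0(1)] by blast
  obtain C where C: "C > Max (insert 0 ((\<lambda>(r, s). \<bar>s\<bar>) ` \<rho>0))"
    "\<And>t. t \<ge> C \<Longrightarrow> sgn (poly q t) = sgn (lead_coeff q)"
    "\<And>t. t \<le> - C \<Longrightarrow> sgn (poly q t) = sgn (lead_coeff q) * (- 1) ^ degree q"
    using poly_sgn_outside[OF pq0(2)] by blast
  have BC: "\<bar>r\<bar> < B" "\<bar>s\<bar> < C" if "(r, s) \<in> \<rho>0" for r s
    using B(1) C(1) that fin0 by auto
  have BC0: "0 < B" "0 < C"
    using B(1) C(1) fin0 by auto
  \<comment> \<open>the sentinels make every interval in which \<open>p\<close> can have a root bounded\<close>
  define \<rho>1 where "\<rho>1 = insert (B, C) (insert (- B, - C) \<rho>0)"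
  have sub1: "\<rho>0 \<subseteq> \<rho>1"
    by (auto simp: \<rho>1_def)
  have fin1: "finite \<rho>1"
    using fin0 by (simp add: \<rho>1_def)
  have oc1: "order_compatible \<rho>1"
    unfolding order_compatible_def
  proof (intro conjI fin1, clarify)
    fix r s assume rs: "(r, s) \<in> \<rho>1"
    show "same_side \<rho>1 r s"
    proof (rule same_sideI)
      fix r' s' assume rs': "(r', s') \<in> \<rho>1"
      have outer: "(r = B \<and> s = C) \<or> (r = - B \<and> s = - C)" if "(r, s) \<in> \<rho>1" "(r, s) \<notin> \<rho>0" for r s
        using that by (auto simp: \<rho>1_def)
      have "(r < r' \<longleftrightarrow> s < s') \<and> (r' < r \<longleftrightarrow> s' < s)"
      proof (cases "(r, s) \<in> \<rho>0")
        case in0: True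
        show ?thesis
        proof (cases "(r', s') \<in> \<rho>0")
          case True
          then show ?thesis
            using same_side_less[OF order_compatibleD[OF oc0 in0] True]
              same_side_greater[OF order_compatibleD[OF oc0 in0] True] by simp
        next
          case False
          then show ?thesis
            using outer[OF rs'] BC[OF in0] by auto
        qed
      next
        case False
        note rs = outer[OF rs False]
        show ?thesis
        proof (cases "(r', s') \<in> \<rho>0")
          case True
          then show ?thesis
            using rs BC[OF True] by auto
        next
          case False
          then show ?thesis
            using rs outer[OF rs'] BC0 by auto
        qed
      qed
      then show "r < r' \<longleftrightarrow> s < s'" "r' < r \<longleftrightarrow> s' < s"
        by blast+
    qed
  qed
  have match1: "sgn (poly a t) = sgn (poly b u)" if "(a, b) \<in> W" "same_side \<rho>1 t u" for a b t u
    using match0 that same_side_mono[OF _ sub1] by blast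
  have endp1: "sgn (poly p r) = sgn (poly q s)" if "(r, s) \<in> \<rho>1" for r s
    using that endp0 B(2,3) C(2,3) lc deg by (auto simp: \<rho>1_def)
  have der1: "\<exists>s. (t, s) \<in> \<rho>1" if "poly (pderiv p) t = 0" for t
    using root1[OF p' pq0(3) that] sub1 by blast
  have der2: "\<exists>r. (r, u) \<in> \<rho>1" if "poly (pderiv q) u = 0" for u
    using root2[OF p' pq0(4) that] sub1 by blast
  \<comment> \<open>Each root of \<open>p\<close> in a cell is paired with each root of
    \<open>q\<close> in the matching cell; \<open>less1\<close> and \<open>less2\<close> show that
    these pairs respect the order.\<close>
  define N where "N = {(a, b). same_side \<rho>1 a b \<and> poly p a = 0 \<and> poly q b = 0}"
  define \<rho>2 where "\<rho>2 = \<rho>1 \<union> N"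
  have sub2: "\<rho>1 \<subseteq> \<rho>2"
    by (auto simp: \<rho>2_def)
  have "N \<subseteq> {x. poly p x = 0} \<times> {x. poly q x = 0}"
    by (auto simp: N_def)
  then have "finite N"
    by (rule finite_subset) (intro finite_cartesian_product poly_roots_finite pq0)
  then have fin2: "finite \<rho>2"
    using fin1 by (simp add: \<rho>2_def)
  have ND: "same_side \<rho>1 a b" "poly p a = 0" "poly q b = 0" if "(a, b) \<in> N" for a b
    using that by (auto simp: N_def)
  \<comment> \<open>Rolle: between two roots of \<open>p\<close> lies a root of its derivative. It
    is a cut point of \<open>\<rho>1\<close>, and its partner separates \<open>b\<close> from
    \<open>b'\<close>.\<close>
  have less1: "b < b'" if N: "(a, b) \<in> N" "(a', b') \<in> N" and "a < a'" for a b a' b'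
  proof -
    obtain z where z: "a < z" "z < a'" "poly (pderiv p) z = 0"
      using poly_MVT[OF \<open>a < a'\<close>, of p] ND(2)[OF N(1)] ND(2)[OF N(2)] \<open>a < a'\<close> by auto
    then obtain s where s: "(z, s) \<in> \<rho>1"
      using der1 by blast
    then have "b < s" "s < b'"
      using same_side_less[OF ND(1)[OF N(1)] s] same_side_greater[OF ND(1)[OF N(2)] s] z by auto
    then show ?thesis
      by simp
  qed
  have less2: "a < a'" if N: "(a, b) \<in> N" "(a', b') \<in> N" and "b < b'" for a b a' b'
  proof -
    obtain z where z: "b < z" "z < b'" "poly (pderiv q) z = 0"
      using poly_MVT[OF \<open>b < b'\<close>, of q] ND(3)[OF N(1)] ND(3)[OF N(2)] \<open>b < b'\<close> by auto
    then obtain r where r: "(r, z) \<in> \<rho>1"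
      using der2 by blast
    then have "a < r" "r < a'"
      using same_side_less[OF ND(1)[OF N(1)] r] same_side_greater[OF ND(1)[OF N(2)] r] z by auto
    then show ?thesis
      by simp
  qed
  have oc2: "order_compatible \<rho>2"
    unfolding order_compatible_def
  proof (intro conjI fin2, clarify)
    fix r s assume rs: "(r, s) \<in> \<rho>2"
    have ss: "same_side \<rho>1 r' s'" if "(r', s') \<in> \<rho>2" for r' s'
      using that order_compatibleD[OF oc1] by (auto simp: \<rho>2_def N_def)
    show "same_side \<rho>2 r s"
    proof (rule same_sideI)
      fix r' s' assume rs': "(r', s') \<in> \<rho>2"
      consider "(r', s') \<in> \<rho>1" | "(r, s) \<in> \<rho>1" | "(r, s) \<in> N" "(r', s') \<in> N"
        using rs rs' by (auto simp: \<rho>2_def)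
      then have "(r < r' \<longleftrightarrow> s < s') \<and> (r' < r \<longleftrightarrow> s' < s)"
      proof cases
        case 1
        then show ?thesis
          using same_side_less[OF ss[OF rs]] same_side_greater[OF ss[OF rs]] by auto
      next
        case 2
        then show ?thesis
          using same_side_less[OF ss[OF rs']] same_side_greater[OF ss[OF rs']] by auto
      next
        case 3
        then show ?thesis
          using less1 less2 by blast
      qed
      then show "r < r' \<longleftrightarrow> s < s'" "r' < r \<longleftrightarrow> s' < s"
        by auto
    qed
  qed
  have new: "sgn (poly p t) = sgn (poly q u)" if tu2: "same_side \<rho>2 t u" for t u
  proof -
    have tu: "same_side \<rho>1 t u"
      using tu2 sub2 by (rule same_side_mono)
    have BC1: "(B, C) \<in> \<rho>1" "(- B, - C) \<in> \<rho>1"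
      by (auto simp: \<rho>1_def)
    consider "t \<in> fst ` \<rho>1" | "t > B" | "t < - B" | "t \<notin> fst ` \<rho>1" "- B < t" "t < B"
      using BC1 by force
    then show ?thesis
    proof cases
      case 1
      then obtain s where s: "(t, s) \<in> \<rho>1"
        by force
      then have "u = s"
        using same_sideD[OF tu s] by (simp add: sgn_zero_iff)
      then show ?thesis
        using endp1 s by simp
    next
      case 2
      then show ?thesis
        using same_side_greater[OF tu BC1(1)] B(2) C(2) lc by simp
    next
      case 3
      then show ?thesis
        using same_side_less[OF tu BC1(2)] B(3) C(3) lc deg by simp
    next
      case 4
      obtain r1 s1 r2 s2 where br:
        "(r1, s1) \<in> \<rho>1" "(r2, s2) \<in> \<rho>1" "r1 < t" "t < r2" "s1 < u" "u < s2"
        and gap: "\<And>a. r1 < a \<Longrightarrow> a < r2 \<Longrightarrow> a \<notin> fst ` \<rho>1"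
        and ss: "\<And>a b. r1 < a \<Longrightarrow> a < r2 \<Longrightarrow> s1 < b \<Longrightarrow> b < s2 \<Longrightarrow> same_side \<rho>1 a b"
        using same_side_bracket[OF tu oc1 4(1) BC1(2) 4(2) BC1(1) 4(3)] by blast
      have nz: "poly (pderiv p) z \<noteq> 0" if "r1 < z" "z < r2" for z
        using gap[OF that] der1 by force
      have eq: "sgn (poly (pderiv p) a) = sgn (poly (pderiv q) b)"
        if "r1 < a" "a < r2" "s1 < b" "b < s2" for a b
        using match1[OF p' ss[OF that]] .
      \<comment> \<open>Such a pair of roots belongs to \<open>\<rho>2\<close>, so \<open>t\<close>
        and \<open>u\<close> lie on the same side of it. Lying weakly on opposite sides as well,
        they must coincide with it.\<close>
      have key: "t = a \<and> u = b"
        if "r1 < a" "a < r2" "s1 < b" "b < s2" "poly p a = 0" "poly q b = 0"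
          "(a \<le> t \<and> u \<le> b) \<or> (t \<le> a \<and> b \<le> u)" for a b
      proof -
        have ab: "(a, b) \<in> \<rho>2"
          using that ss by (simp add: \<rho>2_def N_def)
        show ?thesis
          using same_side_less[OF tu2 ab] same_side_greater[OF tu2 ab] that(7) by auto
      qed
      note ends = endp1[OF br(1)] endp1[OF br(2)]
      have up: "poly p t = 0 \<and> poly q u = 0" if pt: "poly p t \<ge> 0" and qu: "poly q u \<le> 0"
      proof -
        obtain a b where "r1 < a" "a < r2" "s1 < b" "b < s2" "poly p a = 0" "poly q b = 0"
            "(a \<le> t \<and> u \<le> b) \<or> (t \<le> a \<and> b \<le> u)"
          by (rule monotone_roots[OF br(3-6) ends eq nz[OF br(3,4)] pt qu])
        then show ?thesis
          using key[of a b] by simp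
      qed
      have down: "poly p t = 0 \<and> poly q u = 0" if pt: "poly p t \<le> 0" and qu: "poly q u \<ge> 0"
      proof -
        obtain a b where "r1 < a" "a < r2" "s1 < b" "b < s2" "poly (- p) a = 0" "poly (- q) b = 0"
            "(a \<le> t \<and> u \<le> b) \<or> (t \<le> a \<and> b \<le> u)"
        proof (rule monotone_roots[OF br(3-6)])
          show "sgn (poly (- p) r1) = sgn (poly (- q) s1)" "sgn (poly (- p) r2) = sgn (poly (- q) s2)"
            using ends by (simp_all add: sgn_minus)
          show "sgn (poly (pderiv (- p)) z) = sgn (poly (pderiv (- q)) w)"
            if "r1 < z" "z < r2" "s1 < w" "w < s2" for z w
            using eq[OF that] by (simp add: pderiv_minus sgn_minus)
          show "poly (pderiv (- p)) t \<noteq> 0"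
            using nz[OF br(3,4)] by (simp add: pderiv_minus)
          show "0 \<le> poly (- p) t" "poly (- q) u \<le> 0"
            using pt qu by simp_all
        qed
        then show ?thesis
          using key[of a b] by simp
      qed
      \<comment> \<open>By \<open>up\<close> and \<open>down\<close>, weakly opposite signs force
        both values to be zero, which excludes every combination of different signs.\<close>
      show ?thesis
        using up down by (cases "poly p t" "0::real" rule: linorder_cases;
            cases "poly q u" "0::real" rule: linorder_cases) auto
    qed
  qed
  have "sign_matching \<rho>2 (insert (p, q) W)"
    using new match1 oc2 same_side_mono[OF _ sub2] unfolding sign_matching_def by blast
  then show ?thesis
    by blast
qed

section \<open>Polynomials with parameters\<close>

text \<open>The bound concerns coefficients and not \<open>degree\<close>, because the degree of
  \<open>P x\<close> may jump with \<open>x\<close>. It is strict: for \<open>n = 0\<close> only the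
  zero family is left.\<close>

definition poly_families :: "nat \<Rightarrow> ('a::real_normed_vector \<Rightarrow> real poly) set" where
  "poly_families n = {P. (\<forall>i. real_polynomial_function (\<lambda>x. coeff (P x) i)) \<and>
     (\<forall>x. \<forall>i\<ge>n. coeff (P x) i = 0)}"

definition sgn_agree :: "('a \<Rightarrow> real) set \<Rightarrow> 'a \<Rightarrow> 'a \<Rightarrow> bool" where
  "sgn_agree F x y \<longleftrightarrow> (\<forall>f\<in>F. sgn (f x) = sgn (f y))"

text \<open>The elimination property: signs of finitely many polynomials in the parameter alone
  determine, up to an order isomorphism of cut points, how the signs of the whole collection are
  arranged along the line.\<close>

definition signs_controlled :: "('a::real_normed_vector \<Rightarrow> real poly) set \<Rightarrow> bool" where
  "signs_controlled \<P> \<longleftrightarrow> (\<exists>F. finite F \<and> (\<forall>f\<in>F. real_polynomial_function f) \<and>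
     (\<forall>x y. sgn_agree F x y \<longrightarrow> (\<exists>\<rho>. sign_matching \<rho> ((\<lambda>P. (P x, P y)) ` \<P>))))"

lemma poly_familiesI:
  "(\<And>i. real_polynomial_function (\<lambda>x. coeff (P x) i)) \<Longrightarrow>
   (\<And>x i. i \<ge> n \<Longrightarrow> coeff (P x) i = 0) \<Longrightarrow> P \<in> poly_families n"
  by (simp add: poly_families_def)

lemma poly_familiesD:
  assumes "P \<in> poly_families n"
  shows "real_polynomial_function (\<lambda>x. coeff (P x) i)" "i \<ge> n \<Longrightarrow> coeff (P x) i = 0"
  using assms by (auto simp: poly_families_def)

lemma poly_families_mono: "m \<le> n \<Longrightarrow> poly_families m \<subseteq> poly_families n"
  by (auto simp: poly_families_def)

lemma poly_families_pderiv:
  "P \<in> poly_families (Suc n) \<Longrightarrow> (\<lambda>x. pderiv (P x)) \<in> poly_families n"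
  by (auto simp: poly_families_def coeff_pderiv)

lemma poly_families_cutoff:
  assumes "P \<in> poly_families m"
  shows "(\<lambda>x. poly_cutoff n (P x)) \<in> poly_families n"
proof (rule poly_familiesI)
  show "real_polynomial_function (\<lambda>x. coeff (poly_cutoff n (P x)) i)" for i
    using poly_familiesD(1)[OF assms] by (cases "i < n") (auto simp: coeff_poly_cutoff)
qed (simp add: coeff_poly_cutoff)

text \<open>One step of pseudo-division, which cross-multiplies so that coefficients stay polynomial
  in \<open>x\<close>. Coefficient \<open>k\<close> plays the part of the leading coefficient of
  \<open>Q x\<close> and the cutoff removes everything above it, so the terms of degree
  \<open>n\<close> cancel at every \<open>x\<close>, also where \<open>Q x\<close> has another
  degree.\<close>

definition reduction ::
    "nat \<Rightarrow> nat \<Rightarrow> ('a \<Rightarrow> real poly) \<Rightarrow> ('a \<Rightarrow> real poly) \<Rightarrow> 'a \<Rightarrow> real poly" where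
  "reduction n k P Q x =
     smult (coeff (Q x) k) (P x) - smult (coeff (P x) n) (monom 1 (n - k) * poly_cutoff (Suc k) (Q x))"

lemma poly_families_reduction:
  assumes P: "P \<in> poly_families (Suc n)" and Q: "Q \<in> poly_families m" and "k \<le> n"
  shows "reduction n k P Q \<in> poly_families n"
proof (rule poly_familiesI)
  note P = poly_familiesD[OF P] and Q = poly_familiesD[OF Q]
  show "real_polynomial_function (\<lambda>x. coeff (reduction n k P Q x) i)" for i
  proof -
    have "real_polynomial_function
        (\<lambda>x. coeff (monom 1 (n - k) * poly_cutoff (Suc k) (Q x)) i)"
      using Q(1) by (cases "i < n - k"; cases "i - (n - k) < Suc k")
        (auto simp: coeff_monom_mult coeff_poly_cutoff)
    then show ?thesis
      using P(1) Q(1) unfolding reduction_def coeff_diff coeff_smult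
      by (intro real_polynomial_function_diff real_polynomial_function.intros(4))
  qed
  show "coeff (reduction n k P Q x) i = 0" if "i \<ge> n" for x i
  proof (cases "i = n")
    case True
    then show ?thesis
      using \<open>k \<le> n\<close> by (simp add: reduction_def coeff_monom_mult coeff_poly_cutoff)
  next
    case False
    then show ?thesis
      using \<open>k \<le> n\<close> that P(2)[of i] by (simp add: reduction_def coeff_monom_mult coeff_poly_cutoff)
  qed
qed

lemma poly_cutoff_id: "degree p < n \<Longrightarrow> poly_cutoff n p = p"
  by (simp add: poly_eq_iff coeff_poly_cutoff coeff_eq_0)

text \<open>When \<open>k\<close> is the true degree the cutoff changes nothing, and the subtracted
  multiple of \<open>Q x\<close> vanishes at \<open>t\<close>. Up to a leading coefficient, the
  family of smaller degree thus knows the value of \<open>P x\<close> at the roots of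
  \<open>Q x\<close>.\<close>

lemma poly_reduction_root:
  assumes "degree (Q x) = k" "poly (Q x) t = 0"
  shows "poly (reduction n k P Q x) t = coeff (Q x) k * poly (P x) t"
  using assms by (simp add: reduction_def poly_cutoff_id)

lemma sgn_agreeD: "sgn_agree F x y \<Longrightarrow> f \<in> F \<Longrightarrow> sgn (f x) = sgn (f y)"
  by (simp add: sgn_agree_def)

lemma degree_cong_sgn:
  fixes p q :: "real poly"
  assumes "\<And>i. sgn (coeff p i) = sgn (coeff q i)"
  shows "degree p = degree q"
proof -
  have "coeff p i = 0 \<longleftrightarrow> coeff q i = 0" for i
    using assms[of i] by (metis sgn_zero_iff)
  then show ?thesis
    by (simp add: degree_def)
qed

text \<open>Three kinds of families of smaller degree are adjoined: the derivative of
  \<open>P\<close>, its truncation for parameters at which the top coefficient vanishes, and its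
  reductions by all members of \<P> and by the derivative, which give the sign of \<open>P\<close>
  at their roots. The induction hypothesis controls them all, and
  \<open>sign_matching_insert\<close> adds \<open>P\<close>.\<close>

lemma signs_controlled_insert:
  fixes P :: "'a::real_normed_vector \<Rightarrow> real poly"
  assumes P: "P \<in> poly_families (Suc n)" and \<P>: "\<P> \<subseteq> poly_families (Suc n)" "finite \<P>"
    and IH: "\<And>\<L>. finite \<L> \<Longrightarrow> \<L> \<subseteq> poly_families n \<Longrightarrow> signs_controlled (\<P> \<union> \<L>)"
  shows "signs_controlled (insert P \<P>)"
proof -
  define P' where "P' x = pderiv (P x)" for x
  define cut where "cut x = poly_cutoff n (P x)" for x
  define red where "red = (\<Union>Q\<in>insert P' \<P>. \<Union>k\<in>{..n}. {reduction n k P Q})"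
  have P': "P' \<in> poly_families n"
    using poly_families_pderiv[OF P] by (simp add: P'_def[abs_def])
  have cut: "cut \<in> poly_families n"
    using poly_families_cutoff[OF P] by (simp add: cut_def[abs_def])
  have Q: "Q \<in> poly_families (Suc n)" if "Q \<in> insert P' \<P>" for Q
    using that P' \<P>(1) poly_families_mono[of n "Suc n"] by auto
  have red: "red \<subseteq> poly_families n"
    using poly_families_reduction[OF P Q] by (auto simp: red_def)
  have "signs_controlled (\<P> \<union> insert P' (insert cut red))"
    by (rule IH) (use P' cut red \<P>(2) in \<open>auto simp: red_def\<close>)
  then obtain F where F: "finite F" "\<And>f. f \<in> F \<Longrightarrow> real_polynomial_function f" and
    match: "\<And>x y. sgn_agree F x y \<Longrightarrow>
      \<exists>\<rho>. sign_matching \<rho> ((\<lambda>P. (P x, P y)) ` (\<P> \<union> insert P' (insert cut red)))"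
    unfolding signs_controlled_def by blast
  \<comment> \<open>Equal signs of these coefficients make degrees, signs of leading coefficients
    and vanishing of the members agree at the two parameters.\<close>
  define G where "G = (\<Union>Q\<in>insert P (insert P' \<P>). \<Union>k\<in>{..n}. {\<lambda>x. coeff (Q x) k})"
  have "\<exists>\<rho>. sign_matching \<rho> ((\<lambda>P. (P x, P y)) ` insert P \<P>)" if agree: "sgn_agree (F \<union> G) x y" for x y
  proof -
    obtain \<rho> where \<rho>: "sign_matching \<rho> ((\<lambda>P. (P x, P y)) ` (\<P> \<union> insert P' (insert cut red)))"
      using match[of x y] agree by (force simp: sgn_agree_def)
    have sgn_coeff: "sgn (coeff (Q x) i) = sgn (coeff (Q y) i)" if "Q \<in> insert P (insert P' \<P>)" for Q i
    proof (cases "i \<le> n")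
      case True
      then have "(\<lambda>x. coeff (Q x) i) \<in> F \<union> G"
        using that by (auto simp: G_def)
      then show ?thesis
        using sgn_agreeD[OF agree] by blast
    next
      case False
      moreover have "Q \<in> poly_families (Suc n)"
        using that Q P by blast
      ultimately show ?thesis
        using poly_familiesD(2)[of Q "Suc n" i] by simp
    qed
    define W where "W = (\<lambda>P. (P x, P y)) ` insert P' \<P>"
    have W: "sign_matching \<rho> W"
      using \<rho> by (rule sign_matching_mono) (auto simp: W_def)
    have deg: "degree (P x) \<le> n" "degree (P y) \<le> n"
      using poly_familiesD(2)[OF P] by (auto intro!: degree_le)
    have "\<exists>\<rho>. sign_matching \<rho> (insert (P x, P y) W)"
    proof (cases "coeff (P x) n = 0")
      case True
      then have "coeff (P y) n = 0"
        using sgn_coeff[of P n] by (simp add: sgn_zero_iff)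
      have vanish: "coeff (P z) i = 0" if "coeff (P z) n = 0" "n \<le> i" for z i
        using poly_familiesD(2)[OF P, of i z] that by (cases "i = n") auto
      \<comment> \<open>Without its top coefficient \<open>P\<close> equals its truncation, whose
        signs are matched already.\<close>
      have "cut x = P x" "cut y = P y"
        using vanish[OF True] vanish[OF \<open>coeff (P y) n = 0\<close>]
        by (simp_all add: cut_def poly_eq_iff coeff_poly_cutoff)
      then have "sign_matching \<rho> (insert (P x, P y) W)"
        using \<rho> by (elim sign_matching_mono) (auto simp: W_def)
      then show ?thesis ..
    next
      case False
      then have "coeff (P y) n \<noteq> 0"
        using sgn_coeff[of P n] by (auto simp: sgn_zero_iff)
      with False have degn: "degree (P x) = n" "degree (P y) = n"
        using deg by (auto intro!: antisym le_degree)
      show ?thesis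
      proof (cases "n = 0")
        case True
        then have "poly (P x) t = coeff (P x) 0" "poly (P y) u = coeff (P y) 0" for t u
          using degn by (simp_all add: poly_altdef)
        then have "sign_matching \<rho> (insert (P x, P y) W)"
          using W sgn_coeff[of P 0] by (auto simp: sign_matching_def)
        then show ?thesis ..
      next
        case False
        show ?thesis
        proof (rule sign_matching_insert[OF W])
          show "(pderiv (P x), pderiv (P y)) \<in> W"
            by (auto simp: W_def P'_def)
          show "a = 0 \<longleftrightarrow> b = 0" if ab: "(a, b) \<in> W" for a b
          proof -
            obtain Q where "Q \<in> insert P' \<P>" "a = Q x" "b = Q y"
              using ab unfolding W_def by blast
            then have "sgn (coeff a i) = sgn (coeff b i)" for i
              using sgn_coeff[of Q i] by blast
            then show ?thesis
              by (simp add: poly_eq_iff) (metis sgn_zero_iff)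
          qed
          show "degree (P x) = degree (P y)" "0 < degree (P x)"
            using degn False by auto
          show "sgn (lead_coeff (P x)) = sgn (lead_coeff (P y))"
            using degn sgn_coeff[of P n] by simp
          \<comment> \<open>At a root of \<open>Q x\<close> the reduction is the leading coefficient
            of \<open>Q x\<close> times the value of \<open>P x\<close>. The signs of the product
            and of the nonzero factor agree at both parameters, so the factor can be
            cancelled.\<close>
          show "sgn (poly (P x) t) = sgn (poly (P y) u)"
            if ab: "(a, b) \<in> W" and "a \<noteq> 0" and tu: "same_side \<rho> t u" and "poly a t = 0" for a b t u
          proof -
            obtain Q where Q': "Q \<in> insert P' \<P>" "a = Q x" "b = Q y"
              using ab unfolding W_def by blast
            define k where "k = degree a"
            have k: "degree (Q x) = k" "degree (Q y) = k"
              using degree_cong_sgn[of a b] sgn_coeff[of Q] Q' by (auto simp: k_def)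
            have "coeff (Q x) k \<noteq> 0"
              using \<open>a \<noteq> 0\<close> k Q' by auto
            then have "k \<le> n"
              using poly_familiesD(2)[OF Q[OF Q'(1)]] by (meson not_less_eq_eq)
            then have "reduction n k P Q \<in> red"
              using Q' by (auto simp: red_def)
            then have "sgn (poly (reduction n k P Q x) t) = sgn (poly (reduction n k P Q y) u)"
              by (intro sign_matchingD[OF \<rho> _ tu]) auto
            moreover have "poly (Q y) u = 0"
              using sign_matchingD[OF W ab tu] \<open>poly a t = 0\<close> Q' by (simp add: sgn_zero_iff)
            ultimately have "sgn (coeff (Q x) k) * sgn (poly (P x) t) = sgn (coeff (Q y) k) * sgn (poly (P y) u)"
              using \<open>poly a t = 0\<close> k Q' by (simp add: poly_reduction_root sgn_mult)
            then show ?thesis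
              using sgn_coeff[of Q k] Q' \<open>coeff (Q x) k \<noteq> 0\<close> by (auto simp: sgn_zero_iff)
          qed
        qed
      qed
    qed
    moreover have "(\<lambda>P. (P x, P y)) ` insert P \<P> \<subseteq> insert (P x, P y) W"
      by (auto simp: W_def)
    ultimately show ?thesis
      using sign_matching_mono by blast
  qed
  moreover have "finite (F \<union> G)"
    using F(1) \<P>(2) by (auto simp: G_def)
  moreover have "real_polynomial_function f" if "f \<in> F \<union> G" for f
    using that F(2) poly_familiesD(1)[OF P] poly_familiesD(1)[OF Q] by (auto simp: G_def)
  ultimately show ?thesis
    unfolding signs_controlled_def by (intro exI[of _ "F \<union> G"] conjI ballI allI impI)
qed

lemma signs_controlled_poly_families:
  "finite \<P> \<Longrightarrow> \<P> \<subseteq> poly_families n \<Longrightarrow> signs_controlled \<P>"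
proof (induction n arbitrary: \<P>)
  case 0
  then have "P = (\<lambda>_. 0)" if "P \<in> \<P>" for P
    using 0 that by (auto simp: poly_families_def poly_eq_iff fun_eq_iff)
  then have "sign_matching {} ((\<lambda>P. (P x, P y)) ` \<P>)" for x y
    by (force simp: sign_matching_def order_compatible_def)
  then show ?case
    unfolding signs_controlled_def by (intro exI[of _ "{}"]) auto
next
  case (Suc n)
  \<comment> \<open>The set \<L> of families of smaller degree is arbitrary in the inner induction,
    since treating one member of \<P> adjoins further such families. When \<P> is exhausted, the
    outer hypothesis applies.\<close>
  have "signs_controlled (\<P> \<union> \<L>)" if "finite \<L>" "\<L> \<subseteq> poly_families n" for \<L>
    using Suc.prems that
  proof (induction \<P> arbitrary: \<L> rule: finite_induct)
    case empty
    then show ?case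
      using Suc.IH by simp
  next
    case (insert P \<P>)
    have "signs_controlled (insert P (\<P> \<union> \<L>))"
    proof (rule signs_controlled_insert)
      show "P \<in> poly_families (Suc n)" "\<P> \<union> \<L> \<subseteq> poly_families (Suc n)" "finite (\<P> \<union> \<L>)"
        using insert poly_families_mono[of n "Suc n"] by auto
      show "signs_controlled (\<P> \<union> \<L> \<union> \<L>')" if "finite \<L>'" "\<L>' \<subseteq> poly_families n" for \<L>'
        using insert.IH[of "\<L> \<union> \<L>'"] insert.prems that by (simp add: Un_assoc)
    qed
    then show ?case
      by simp
  qed
  from this[of "{}"] show ?case
    by simp
qed

section \<open>Hilbert's basis theorem\<close>

text \<open>Rings are subsets of a ring type, so that coordinate rings in more and more variables
  can live in one type of functions.\<close>

definition is_subring :: "'r::comm_ring_1 set \<Rightarrow> bool" where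
  "is_subring A \<longleftrightarrow> 0 \<in> A \<and> 1 \<in> A \<and> (\<forall>x\<in>A. - x \<in> A) \<and>
     (\<forall>x\<in>A. \<forall>y\<in>A. x + y \<in> A \<and> x * y \<in> A)"

text \<open>For a subring \<open>A\<close> and \<open>G \<subseteq> A\<close> this is the ideal of
  \<open>A\<close> generated by \<open>G\<close>.\<close>

inductive_set combinations :: "'r::comm_ring_1 set \<Rightarrow> 'r set \<Rightarrow> 'r set" for A G where
  zero: "0 \<in> combinations A G"
| step: "a \<in> A \<Longrightarrow> g \<in> G \<Longrightarrow> s \<in> combinations A G \<Longrightarrow> a * g + s \<in> combinations A G"

text \<open>The generators must come from \<open>H\<close> itself; this is what later selects
  finitely many equations from an infinite system.\<close>

definition noetherian :: "'r::comm_ring_1 set \<Rightarrow> bool" where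
  "noetherian A \<longleftrightarrow> (\<forall>H\<subseteq>A. \<exists>G\<subseteq>H. finite G \<and> H \<subseteq> combinations A G)"

lemma is_subringD:
  assumes "is_subring A"
  shows "0 \<in> A" "1 \<in> A" "x \<in> A \<Longrightarrow> - x \<in> A" "x \<in> A \<Longrightarrow> y \<in> A \<Longrightarrow> x + y \<in> A"
    "x \<in> A \<Longrightarrow> y \<in> A \<Longrightarrow> x * y \<in> A"
  using assms by (auto simp: is_subring_def)

lemma is_subring_sum:
  assumes "is_subring A" "\<And>i. i \<in> I \<Longrightarrow> f i \<in> A"
  shows "sum f I \<in> A"
  using assms(2) by (induction I rule: infinite_finite_induct) (auto intro: is_subringD[OF assms(1)])

lemma noetherianE:
  assumes "noetherian A" "H \<subseteq> A"
  obtains G where "G \<subseteq> H" "finite G" "H \<subseteq> combinations A G"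
  using assms by (auto simp: noetherian_def)

lemma combinations_mono: "G \<subseteq> H \<Longrightarrow> combinations A G \<subseteq> combinations A H"
proof
  fix x assume "G \<subseteq> H" "x \<in> combinations A G"
  from this(2,1) show "x \<in> combinations A H"
    by induction (auto intro: combinations.intros)
qed

lemma combinations_superset: "is_subring A \<Longrightarrow> G \<subseteq> combinations A G"
  using combinations.step[of 1 A _ G 0] by (auto intro: combinations.zero is_subringD)

lemma combinations_add:
  "x \<in> combinations A G \<Longrightarrow> y \<in> combinations A G \<Longrightarrow> x + y \<in> combinations A G"
  by (induction rule: combinations.induct) (auto simp: add.assoc intro: combinations.intros)

lemma combinations_mult:
  assumes "is_subring A" "c \<in> A"
  shows "x \<in> combinations A G \<Longrightarrow> c * x \<in> combinations A G"
proof (induction rule: combinations.induct)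
  case (step a g s)
  have "c * a \<in> A"
    using assms step(1) by (rule is_subringD)
  then have "(c * a) * g + c * s \<in> combinations A G"
    using step by (intro combinations.step)
  then show ?case
    by (simp add: algebra_simps)
qed (simp add: combinations.zero)

lemma combinations_trans:
  assumes A: "is_subring A" and G: "G \<subseteq> combinations A H"
  shows "combinations A G \<subseteq> combinations A H"
proof
  fix x assume "x \<in> combinations A G"
  then show "x \<in> combinations A H"
    by induction (use G in \<open>auto intro!: combinations.zero combinations_add combinations_mult[OF A]\<close>)
qed

lemma combinations_finite_support:
  assumes "x \<in> combinations A H"
  shows "\<exists>G\<subseteq>H. finite G \<and> x \<in> combinations A G"
  using assms
proof induction
  case zero
  then show ?case
    by (auto intro: combinations.zero)
next
  case (step a g s)
  then obtain G where G: "G \<subseteq> H" "finite G" "s \<in> combinations A G"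
    by blast
  then have "a * g + s \<in> combinations A (insert g G)"
    using step combinations_mono[of G "insert g G"] by (intro combinations.step) auto
  then show ?case
    using G step by (intro exI[of _ "insert g G"]) auto
qed

lemma combinations_finite_supports:
  assumes "finite J" "J \<subseteq> combinations A H"
  shows "\<exists>G\<subseteq>H. finite G \<and> J \<subseteq> combinations A G"
  using assms
proof (induction J)
  case (insert x J)
  obtain G where G: "G \<subseteq> H" "finite G" "J \<subseteq> combinations A G"
    using insert by auto
  obtain G' where G': "G' \<subseteq> H" "finite G'" "x \<in> combinations A G'"
    using combinations_finite_support[of x A H] insert.prems by auto
  show ?case
    using G G' combinations_mono[of G "G \<union> G'" A] combinations_mono[of G' "G \<union> G'" A]
    by (intro exI[of _ "G \<union> G'"]) auto
qed (auto intro: exI[of _ "{}"])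

definition polys_over :: "'r::comm_ring_1 set \<Rightarrow> 'r poly set" where
  "polys_over A = {p. \<forall>i. coeff p i \<in> A}"

lemma is_subring_polys_over:
  assumes "is_subring A"
  shows "is_subring (polys_over A)"
  unfolding is_subring_def
proof (intro conjI ballI)
  note A = is_subringD[OF assms]
  show "0 \<in> polys_over A" "1 \<in> polys_over A"
    using A(1,2) by (auto simp: polys_over_def coeff_1)
  show "- p \<in> polys_over A" if "p \<in> polys_over A" for p
    using that A(3) by (simp add: polys_over_def)
  show "p + q \<in> polys_over A" "p * q \<in> polys_over A"
    if "p \<in> polys_over A" "q \<in> polys_over A" for p q
    using that by (auto simp: polys_over_def coeff_mult intro!: is_subring_sum[OF assms] A(4,5))
qed

text \<open>The sets \<open>L n\<close> of coefficients at \<open>n\<close> of members of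
  \<open>I\<close> of degree at most \<open>n\<close> are all generated by the coefficients of one
  finite set of members. Subtracting a suitable combination of these members lowers the degree bound
  of any element of \<open>I\<close> until nothing is left.\<close>

theorem hilbert_basis:
  fixes A :: "'r::comm_ring_1 set"
  assumes A: "is_subring A" and noeth: "noetherian A"
  shows "noetherian (polys_over A)"
  unfolding noetherian_def
proof (intro allI impI)
  fix H assume H: "H \<subseteq> polys_over A"
  let ?R = "polys_over A"
  note R = is_subring_polys_over[OF A]
  define I where "I = combinations ?R H"
  have I_add: "p + q \<in> I" if "p \<in> I" "q \<in> I" for p q
    using that by (simp add: I_def combinations_add)
  have I_mult: "p * q \<in> I" if "p \<in> ?R" "q \<in> I" for p q
    using that by (simp add: I_def combinations_mult[OF R])
  have I_sub: "I \<subseteq> ?R"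
  proof
    fix p assume "p \<in> I"
    then show "p \<in> ?R"
      unfolding I_def by induction (use H in \<open>auto intro!: is_subringD[OF R]\<close>)
  qed
  \<comment> \<open>The coefficient at \<open>n\<close> may be zero, so that \<open>gen\<close> can
    descend along a degree bound instead of the exact degree.\<close>
  define L where "L n = {coeff p n |p. p \<in> I \<and> degree p \<le> n}" for n
  have L_sub: "L n \<subseteq> A" for n
    using I_sub by (auto simp: L_def polys_over_def)
  \<comment> \<open>Each generator is stored with an exponent \<open>k\<close>, possibly larger than
    its degree, and contributes to every \<open>n\<close> from \<open>k\<close> on.\<close>
  define lead where "lead K n = {coeff p k |p k. (p, k) \<in> K \<and> k \<le> n}" for K :: "('r poly \<times> nat) set" and n
  obtain K where K: "finite K" "\<And>p k. (p, k) \<in> K \<Longrightarrow> p \<in> I \<and> degree p \<le> k"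
    "\<And>n. L n \<subseteq> combinations A (lead K n)"
  proof -
    obtain G where G: "G \<subseteq> (\<Union>n. L n)" "finite G" "(\<Union>n. L n) \<subseteq> combinations A G"
      using noetherianE[OF noeth, of "\<Union>n. L n"] L_sub by blast
    then have "\<forall>g\<in>G. \<exists>p k. g = coeff p k \<and> p \<in> I \<and> degree p \<le> k"
      by (force simp: L_def)
    then obtain P k where Pk: "\<And>g. g \<in> G \<Longrightarrow> g = coeff (P g) (k g) \<and> P g \<in> I \<and> degree (P g) \<le> k g"
      by metis
    \<comment> \<open>From degree \<open>N\<close> on, the finitely many generators of the union suffice.\<close>
    define N where "N = Max (insert 0 (k ` G))"
    have N: "k g \<le> N" if "g \<in> G" for g
      using that G(2) by (simp add: N_def)
    have "\<forall>n. \<exists>G\<subseteq>L n. finite G \<and> L n \<subseteq> combinations A G"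
      using noeth L_sub unfolding noetherian_def by blast
    then obtain G' where G': "\<And>n. G' n \<subseteq> L n" "\<And>n. finite (G' n)" "\<And>n. L n \<subseteq> combinations A (G' n)"
      by metis
    then have "\<forall>n. \<forall>g\<in>G' n. \<exists>p. g = coeff p n \<and> p \<in> I \<and> degree p \<le> n"
      by (force simp: L_def)
    then obtain Q where Q: "\<And>n g. g \<in> G' n \<Longrightarrow> g = coeff (Q n g) n \<and> Q n g \<in> I \<and> degree (Q n g) \<le> n"
      by metis
    define K where "K = (\<lambda>g. (P g, k g)) ` G \<union> (\<Union>n<N. (\<lambda>g. (Q n g, n)) ` G' n)"
    show thesis
    proof (rule that)
      show "finite K"
        using G(2) G'(2) by (auto simp: K_def)
      show "p \<in> I \<and> degree p \<le> k" if "(p, k) \<in> K" for p k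
        using that Pk Q by (auto simp: K_def)
      show "L n \<subseteq> combinations A (lead K n)" for n
      proof (cases "n < N")
        case True
        have "G' n \<subseteq> lead K n"
        proof
          fix g assume "g \<in> G' n"
          then show "g \<in> lead K n"
            using Q[of g n] True by (force simp: lead_def K_def)
        qed
        then show ?thesis
          using G'(3)[of n] combinations_mono[of "G' n" "lead K n" A] by blast
      next
        case False
        have "G \<subseteq> lead K n"
        proof
          fix g assume g: "g \<in> G"
          then have "(P g, k g) \<in> K" "k g \<le> n"
            using N[of g] False by (auto simp: K_def)
          then show "g \<in> lead K n"
            using Pk[OF g] unfolding lead_def by blast
        qed
        then show ?thesis
          using G(3) combinations_mono[of G "lead K n" A] by blast
      qed
    qed
  qed
  define J where "J = fst ` K"
  have J: "finite J" "J \<subseteq> I"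
    using K(1,2) by (auto simp: J_def)
  \<comment> \<open>Multiplication by \<open>monom a (n - k)\<close> shifts the coefficient at
    \<open>k\<close> to position \<open>n\<close> and keeps the degree at most
    \<open>n\<close>.\<close>
  have lift: "\<exists>q \<in> combinations ?R J. degree q \<le> n \<and> coeff q n = c"
    if "c \<in> combinations A (lead K n)" for c n
    using that
  proof induction
    case zero
    then show ?case
      by (intro bexI[of _ 0] combinations.zero) auto
  next
    case (step a g s)
    then obtain q where q: "q \<in> combinations ?R J" "degree q \<le> n" "coeff q n = s"
      by blast
    obtain p k where p: "(p, k) \<in> K" "k \<le> n" "g = coeff p k"
      using step by (auto simp: lead_def)
    have "p \<in> J"
      using p(1) by (force simp: J_def)
    moreover have "monom a (n - k) \<in> ?R"
      using step(1) is_subringD(1)[OF A] by (simp add: polys_over_def)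
    ultimately have "monom a (n - k) * p + q \<in> combinations ?R J"
      using q(1) by (intro combinations.step)
    moreover have "degree (monom a (n - k) * p) \<le> n"
      using degree_mult_le[of "monom a (n - k)" p] degree_monom_le[of a "n - k"] K(2)[OF p(1)] p(2) by linarith
    then have "degree (monom a (n - k) * p + q) \<le> n"
      using q(2) by (intro degree_add_le)
    moreover have "coeff (monom a (n - k) * p + q) n = a * g + s"
      using p q by (simp add: coeff_monom_mult)
    ultimately show ?case
      by blast
  qed
  have gen: "p \<in> combinations ?R J" if "p \<in> I" "\<And>i. i \<ge> n \<Longrightarrow> coeff p i = 0" for p n
    using that
  proof (induction n arbitrary: p)
    case 0
    then have "p = 0"
      by (simp add: poly_eq_iff)
    then show ?case
      by (simp add: combinations.zero)
  next
    case (Suc n)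
    have "degree p \<le> n"
      using Suc.prems by (intro degree_le) auto
    then have "coeff p n \<in> combinations A (lead K n)"
      using K(3)[of n] Suc.prems(1) by (auto simp: L_def)
    then obtain q where q: "q \<in> combinations ?R J" "degree q \<le> n" "coeff q n = coeff p n"
      using lift by blast
    have "q \<in> I"
      using q(1) combinations_trans[OF R, of J H] J by (auto simp: I_def)
    then have "- 1 * q \<in> I"
      by (intro I_mult is_subringD[OF R])
    then have "p + - 1 * q \<in> I"
      using Suc.prems by (intro I_add)
    moreover have "coeff (p + - 1 * q) i = 0" if "i \<ge> n" for i
      using q that Suc.prems(2)[of i] by (cases "i = n") (auto simp: coeff_eq_0)
    ultimately have "p + - 1 * q \<in> combinations ?R J"
      by (rule Suc.IH)
    then have "(p + - 1 * q) + q \<in> combinations ?R J"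
      using q(1) by (rule combinations_add)
    then show ?case
      by simp
  qed
  \<comment> \<open>Members of \<open>J\<close> lie in the ideal generated by \<open>H\<close> but
    perhaps not in \<open>H\<close>; each of these finitely many members involves only finitely many
    elements of \<open>H\<close>.\<close>
  obtain G where G: "G \<subseteq> H" "finite G" "J \<subseteq> combinations ?R G"
    using combinations_finite_supports[OF J(1), of ?R H] J(2) unfolding I_def by auto
  have "H \<subseteq> combinations ?R G"
  proof
    fix p assume "p \<in> H"
    then have "p \<in> I"
      using combinations_superset[OF R] by (auto simp: I_def)
    then have "p \<in> combinations ?R J"
      by (rule gen[of _ "Suc (degree p)"]) (simp add: coeff_eq_0)
    then show "p \<in> combinations ?R G"
      using combinations_trans[OF R G(3)] by blast
  qed
  then show "\<exists>G\<subseteq>H. finite G \<and> H \<subseteq> combinations ?R G"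
    using G by blast
qed

lemma noetherian_image:
  fixes \<phi> :: "'r::comm_ring_1 \<Rightarrow> 's::comm_ring_1"
  assumes hom: "\<And>x y. \<phi> (x + y) = \<phi> x + \<phi> y" "\<And>x y. \<phi> (x * y) = \<phi> x * \<phi> y" "\<phi> 0 = 0"
    and noeth: "noetherian A"
  shows "noetherian (\<phi> ` A)"
  unfolding noetherian_def
proof (intro allI impI)
  fix H assume "H \<subseteq> \<phi> ` A"
  then obtain H' where H': "H' \<subseteq> A" "H = \<phi> ` H'"
    by (auto simp: subset_image_iff)
  obtain G where G: "G \<subseteq> H'" "finite G" "H' \<subseteq> combinations A G"
    using noetherianE[OF noeth H'(1)] .
  have "\<phi> x \<in> combinations (\<phi> ` A) (\<phi> ` G)" if "x \<in> combinations A G" for x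
    using that by induction (auto simp: hom intro: combinations.intros)
  then have "H \<subseteq> combinations (\<phi> ` A) (\<phi> ` G)"
    using G H' by blast
  then show "\<exists>G\<subseteq>H. finite G \<and> H \<subseteq> combinations (\<phi> ` A) G"
    using G H' by (intro exI[of _ "\<phi> ` G"]) auto
qed

section \<open>The coordinate ring of polynomial functions\<close>

lemma sum_apply: "sum f I x = (\<Sum>i\<in>I. f i x)" for f :: "'i \<Rightarrow> 'a \<Rightarrow> real"
  by (induction I rule: infinite_finite_induct) auto

text \<open>Coordinates are adjoined one at a time, starting from the constants. Evaluation at the
  new coordinate function is a ring homomorphism on the polynomials over the previous ring, so its
  image is Noetherian by \<open>hilbert_basis\<close>.\<close>

lemma noetherian_coordinate_ring:
  fixes B :: "'a::euclidean_space set"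
  assumes "finite B"
  shows "\<exists>R :: ('a \<Rightarrow> real) set. is_subring R \<and> noetherian R \<and>
    (\<forall>c. (\<lambda>_. c) \<in> R) \<and> (\<forall>b\<in>B. (\<lambda>x. x \<bullet> b) \<in> R)"
  using assms
proof (induction B)
  case empty
  let ?R = "range (\<lambda>c (_::'a). c :: real)"
  have "is_subring ?R"
    by (auto simp: is_subring_def zero_fun_def one_fun_def plus_fun_def times_fun_def fun_Compl_def)
  moreover have "noetherian ?R"
    unfolding noetherian_def
  proof (intro allI impI)
    fix H assume H: "H \<subseteq> ?R"
    show "\<exists>G\<subseteq>H. finite G \<and> H \<subseteq> combinations ?R G"
    proof (cases "H \<subseteq> {0}")
      case True
      then show ?thesis
        by (intro exI[of _ "{}"]) (auto intro: combinations.zero)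
    next
      case False
      \<comment> \<open>The constants form a field, so a single nonzero constant generates all of
        them.\<close>
      then obtain c where c: "(\<lambda>_. c) \<in> H" "c \<noteq> 0"
        using H by (fastforce simp: zero_fun_def)
      have "(\<lambda>_. d) \<in> combinations ?R {\<lambda>_. c}" for d
      proof -
        have "(\<lambda>_. d / c) * (\<lambda>_. c) + 0 \<in> combinations ?R {\<lambda>_. c}"
          by (intro combinations.step combinations.zero) auto
        then show ?thesis
          using c by (simp add: times_fun_def)
      qed
      then show ?thesis
        using c H by (intro exI[of _ "{\<lambda>_. c}"]) auto
    qed
  qed
  ultimately show ?case
    by blast
next
  case (insert b B)
  then obtain R :: "('a \<Rightarrow> real) set" where R: "is_subring R" "noetherian R"
    "\<And>c. (\<lambda>_. c) \<in> R" "\<And>b. b \<in> B \<Longrightarrow> (\<lambda>x. x \<bullet> b) \<in> R"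
    by blast
  define X :: "'a \<Rightarrow> real" where "X = (\<lambda>x. x \<bullet> b)"
  let ?S = "(\<lambda>p. poly p X) ` polys_over R"
  note P = is_subring_polys_over[OF R(1)]
  have "is_subring ?S"
    unfolding is_subring_def
  proof (intro conjI ballI)
    show "0 \<in> ?S" "1 \<in> ?S"
      using is_subringD(1,2)[OF P] by (auto intro: rev_image_eqI[of 0] rev_image_eqI[of 1])
    fix x assume "x \<in> ?S"
    then obtain p where p: "p \<in> polys_over R" "x = poly p X"
      by blast
    show "- x \<in> ?S"
      using p by (intro rev_image_eqI[of "- p"]) (auto intro: is_subringD[OF P])
    fix y assume "y \<in> ?S"
    then obtain q where q: "q \<in> polys_over R" "y = poly q X"
      by blast
    show "x + y \<in> ?S"
      using p q by (intro rev_image_eqI[of "p + q"]) (auto intro: is_subringD[OF P])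
    show "x * y \<in> ?S"
      using p q by (intro rev_image_eqI[of "p * q"]) (auto intro: is_subringD[OF P])
  qed
  moreover have "noetherian ?S"
    by (rule noetherian_image[OF _ _ _ hilbert_basis[OF R(1,2)]]) auto
  moreover have sub: "f \<in> ?S" if "f \<in> R" for f
    using that is_subringD(1)[OF R(1)]
    by (intro rev_image_eqI[of "[:f:]"]) (auto simp: polys_over_def coeff_pCons split: nat.splits)
  moreover have "X \<in> ?S"
    using is_subringD(1,2)[OF R(1)]
    by (intro rev_image_eqI[of "[:0, 1:]"]) (auto simp: polys_over_def coeff_pCons split: nat.splits)
  ultimately show ?case
    using R(3,4) by (intro exI[of _ ?S]) (auto simp: X_def)
qed

text \<open>All members of \<open>H\<close> are combinations of finitely many of them and therefore
  vanish wherever those do. This replaces the arbitrary system of equations of a basic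
  semi-algebraic set by a finite one.\<close>

lemma real_polynomial_functions_common_zeros:
  fixes H :: "('a::euclidean_space \<Rightarrow> real) set"
  assumes H: "\<And>h. h \<in> H \<Longrightarrow> real_polynomial_function h"
  obtains G where "G \<subseteq> H" "finite G" "\<And>x. (\<forall>h\<in>G. h x = 0) \<Longrightarrow> (\<forall>h\<in>H. h x = 0)"
proof -
  obtain R :: "('a \<Rightarrow> real) set" where R: "is_subring R" "noetherian R"
    "\<And>c. (\<lambda>_. c) \<in> R" "\<And>b. b \<in> Basis \<Longrightarrow> (\<lambda>x. x \<bullet> b) \<in> R"
    using noetherian_coordinate_ring[OF finite_Basis] by blast
  have "f \<in> R" if "real_polynomial_function f" for f
    using that
  proof induction
    case (linear f)
    have "f = (\<Sum>b\<in>Basis. (\<lambda>x. x \<bullet> b) * (\<lambda>_. f b))"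
    proof
      fix x
      have "f x = f (\<Sum>b\<in>Basis. (x \<bullet> b) *\<^sub>R b)"
        by (simp add: euclidean_representation)
      also have "\<dots> = (\<Sum>b\<in>Basis. (x \<bullet> b) * f b)"
        using linear by (simp add: linear_sum linear_cmul bounded_linear.linear)
      finally show "f x = (\<Sum>b\<in>Basis. (\<lambda>x. x \<bullet> b) * (\<lambda>_. f b)) x"
        by (simp add: sum_apply)
    qed
    moreover have "(\<Sum>b\<in>Basis. (\<lambda>x. x \<bullet> b) * (\<lambda>_. f b)) \<in> R"
      by (intro is_subring_sum[OF R(1)] is_subringD(5)[OF R(1)] R(3,4))
    ultimately show ?case
      by simp
  next
    case (add f g)
    then show ?case
      using is_subringD(4)[OF R(1), of f g] by (simp add: plus_fun_def)
  next
    case (mult f g)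
    then show ?case
      using is_subringD(5)[OF R(1), of f g] by (simp add: times_fun_def)
  qed (rule R(3))
  then have "H \<subseteq> R"
    using H by blast
  then obtain G where G: "G \<subseteq> H" "finite G" "H \<subseteq> combinations R G"
    using noetherianE[OF R(2)] by blast
  have "h x = 0" if "\<forall>g\<in>G. g x = 0" "h \<in> combinations R G" for h x
    using that(2,1) by induction auto
  then show thesis
    using G by (intro that[of G]) auto
qed

section \<open>The Tarski--Seidenberg theorem\<close>

text \<open>By the two conversion lemmas below this describes the same sets as
  \<open>semialgebraic\<close>, in a form suited to Boolean operations and projections. One
  implication suffices because \<open>sgn_agree\<close> is symmetric.\<close>

definition sign_definable :: "'a::real_normed_vector set \<Rightarrow> bool" where
  "sign_definable S \<longleftrightarrow> (\<exists>F. finite F \<and> (\<forall>f\<in>F. real_polynomial_function f) \<and>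
     (\<forall>x y. sgn_agree F x y \<longrightarrow> x \<in> S \<longrightarrow> y \<in> S))"

lemma sgn_agree_Un: "sgn_agree (F \<union> G) x y \<longleftrightarrow> sgn_agree F x y \<and> sgn_agree G x y"
  by (auto simp: sgn_agree_def)

lemma sign_definableI:
  assumes "finite F" "\<And>f. f \<in> F \<Longrightarrow> real_polynomial_function f"
    "\<And>x y. sgn_agree F x y \<Longrightarrow> x \<in> S \<Longrightarrow> y \<in> S"
  shows "sign_definable S"
  using assms by (auto simp: sign_definable_def)

lemma sign_definableE:
  assumes "sign_definable S"
  obtains F where "finite F" "\<And>f. f \<in> F \<Longrightarrow> real_polynomial_function f"
    "\<And>x y. sgn_agree F x y \<Longrightarrow> x \<in> S \<Longrightarrow> y \<in> S"
  using assms by (auto simp: sign_definable_def)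

lemma sign_definable_Int:
  assumes "sign_definable S" "sign_definable T"
  shows "sign_definable (S \<inter> T)"
proof -
  obtain F where F: "finite F" "\<And>f. f \<in> F \<Longrightarrow> real_polynomial_function f"
    "\<And>x y. sgn_agree F x y \<Longrightarrow> x \<in> S \<Longrightarrow> y \<in> S"
    using sign_definableE[OF assms(1)] by blast
  obtain G where G: "finite G" "\<And>f. f \<in> G \<Longrightarrow> real_polynomial_function f"
    "\<And>x y. sgn_agree G x y \<Longrightarrow> x \<in> T \<Longrightarrow> y \<in> T"
    using sign_definableE[OF assms(2)] by blast
  show ?thesis
  proof (rule sign_definableI[of "F \<union> G"])
    show "y \<in> S \<inter> T" if "sgn_agree (F \<union> G) x y" "x \<in> S \<inter> T" for x y
      using that F(3)[of x y] G(3)[of x y] by (auto simp: sgn_agree_Un)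
  qed (use F(1,2) G(1,2) in auto)
qed

lemma sign_definable_Un:
  assumes "sign_definable S" "sign_definable T"
  shows "sign_definable (S \<union> T)"
proof -
  obtain F where F: "finite F" "\<And>f. f \<in> F \<Longrightarrow> real_polynomial_function f"
    "\<And>x y. sgn_agree F x y \<Longrightarrow> x \<in> S \<Longrightarrow> y \<in> S"
    using sign_definableE[OF assms(1)] by blast
  obtain G where G: "finite G" "\<And>f. f \<in> G \<Longrightarrow> real_polynomial_function f"
    "\<And>x y. sgn_agree G x y \<Longrightarrow> x \<in> T \<Longrightarrow> y \<in> T"
    using sign_definableE[OF assms(2)] by blast
  show ?thesis
  proof (rule sign_definableI[of "F \<union> G"])
    show "y \<in> S \<union> T" if "sgn_agree (F \<union> G) x y" "x \<in> S \<union> T" for x y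
      using that F(3)[of x y] G(3)[of x y] by (auto simp: sgn_agree_Un)
  qed (use F(1,2) G(1,2) in auto)
qed

lemma sign_definable_Union:
  "finite \<B> \<Longrightarrow> (\<And>B. B \<in> \<B> \<Longrightarrow> sign_definable B) \<Longrightarrow> sign_definable (\<Union>\<B>)"
proof (induction rule: finite_induct)
  case empty
  show ?case
    by (rule sign_definableI[of "{}"]) auto
qed (simp add: sign_definable_Un)

lemma sign_definable_zeros:
  assumes "finite F" "\<And>f. f \<in> F \<Longrightarrow> real_polynomial_function f"
  shows "sign_definable {x. \<forall>f\<in>F. f x = 0}"
proof (rule sign_definableI[OF assms])
  show "y \<in> {x. \<forall>f\<in>F. f x = 0}" if "sgn_agree F x y" "x \<in> {x. \<forall>f\<in>F. f x = 0}" for x y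
    using that by (force simp: sgn_agree_def sgn_zero_iff)
qed

lemma sign_definable_pos:
  assumes "finite F" "\<And>f. f \<in> F \<Longrightarrow> real_polynomial_function f"
  shows "sign_definable {x. \<forall>f\<in>F. f x > 0}"
proof (rule sign_definableI[OF assms])
  show "y \<in> {x. \<forall>f\<in>F. f x > 0}" if "sgn_agree F x y" "x \<in> {x. \<forall>f\<in>F. f x > 0}" for x y
    using that by (auto simp: sgn_agree_def sgn_1_pos)
qed

lemma sign_definable_vimage:
  fixes h :: "'a::euclidean_space \<Rightarrow> 'b::euclidean_space"
  assumes h: "polynomial_function h" and "sign_definable S"
  shows "sign_definable (h -` S)"
proof -
  obtain F where F: "finite F" "\<And>f. f \<in> F \<Longrightarrow> real_polynomial_function f"
    "\<And>x y. sgn_agree F x y \<Longrightarrow> x \<in> S \<Longrightarrow> y \<in> S"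
    using sign_definableE[OF assms(2)] by blast
  show ?thesis
  proof (rule sign_definableI[of "(\<lambda>f. f \<circ> h) ` F"])
    show "real_polynomial_function f" if "f \<in> (\<lambda>f. f \<circ> h) ` F" for f
      using that F(2) h by (auto intro: real_polynomial_function_compose)
    show "y \<in> h -` S" if "sgn_agree ((\<lambda>f. f \<circ> h) ` F) x y" "x \<in> h -` S" for x y
      using F(3)[of "h x" "h y"] that by (simp add: sgn_agree_def)
  qed (simp add: F(1))
qed

lemma semialgebraic_imp_sign_definable:
  assumes "semialgebraic S"
  shows "sign_definable S"
proof -
  have "sign_definable B" if basic: "basic_semialgebraic B" for B :: "'a set"
  proof -
    obtain F H where FH: "finite F" "\<And>f. f \<in> F \<Longrightarrow> real_polynomial_function f"
      "\<And>h. h \<in> H \<Longrightarrow> real_polynomial_function h"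
      and B: "B = {\<theta>. (\<forall>f\<in>F. f \<theta> > 0) \<and> (\<forall>h\<in>H. h \<theta> = 0)}"
      using basic unfolding basic_semialgebraic_def by blast
    obtain G where G: "G \<subseteq> H" "finite G" "\<And>x. (\<forall>h\<in>G. h x = 0) \<Longrightarrow> (\<forall>h\<in>H. h x = 0)"
      using real_polynomial_functions_common_zeros[of H] FH(3) by blast
    have "B = {x. \<forall>f\<in>F. f x > 0} \<inter> {x. \<forall>h\<in>G. h x = 0}"
      using G by (auto simp: B)
    then show ?thesis
      using FH G by (auto intro!: sign_definable_Int sign_definable_pos sign_definable_zeros)
  qed
  then show ?thesis
    using assms by (auto simp: semialgebraic_def intro: sign_definable_Union)
qed

text \<open>\<open>S\<close> is the union of the sign cells of its points. Only finitely many sign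
  vectors on \<open>F\<close> occur, and each cell is basic, negative signs being turned into
  positivity of negated polynomials.\<close>

lemma sign_definable_imp_semialgebraic:
  fixes S :: "'a::euclidean_space set"
  assumes "sign_definable S"
  shows "semialgebraic S"
proof -
  obtain F where F: "finite F" "\<And>f. f \<in> F \<Longrightarrow> real_polynomial_function f"
    "\<And>x y. sgn_agree F x y \<Longrightarrow> x \<in> S \<Longrightarrow> y \<in> S"
    using sign_definableE[OF assms] by blast
  define cell where "cell \<sigma> = {x. \<forall>f\<in>F. sgn (f x) = \<sigma> f}" for \<sigma>
  \<comment> \<open>\<open>restrict\<close> fixes the values outside \<open>F\<close>, so that the
    sign vectors lie in a finite function space.\<close>
  define \<Sigma> where "\<Sigma> = (\<lambda>x. restrict (\<lambda>f. sgn (f x)) F) ` S"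
  have "\<Sigma> \<subseteq> (\<Pi>\<^sub>E f\<in>F. {- 1, 0, 1})"
    by (auto simp: \<Sigma>_def sgn_1_pos sgn_1_neg sgn_zero_iff)
  then have "finite \<Sigma>"
    by (rule finite_subset) (auto intro: finite_PiE F(1))
  have basic: "basic_semialgebraic (cell \<sigma>)" if "\<sigma> \<in> \<Sigma>" for \<sigma>
    unfolding basic_semialgebraic_def
  proof (intro exI conjI ballI)
    let ?P = "{f \<in> F. \<sigma> f = 1} \<union> (\<lambda>f x. - f x) ` {f \<in> F. \<sigma> f = - 1}"
    let ?Z = "{f \<in> F. \<sigma> f = 0}"
    show "finite ?P"
      using F(1) by simp
    show "real_polynomial_function f" if "f \<in> ?P" for f
      using that F(2) by auto
    show "real_polynomial_function f" if "f \<in> ?Z" for f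
      using that F(2) by auto
    have \<sigma>: "\<sigma> f = 1 \<or> \<sigma> f = 0 \<or> \<sigma> f = - 1" if "f \<in> F" for f
      using \<open>\<sigma> \<in> \<Sigma>\<close> that by (auto simp: \<Sigma>_def sgn_1_pos sgn_1_neg sgn_zero_iff)
    show "cell \<sigma> = {x. (\<forall>f\<in>?P. f x > 0) \<and> (\<forall>f\<in>?Z. f x = 0)}"
    proof (intro set_eqI iffI)
      fix x assume "x \<in> cell \<sigma>"
      then have "\<sigma> f = sgn (f x)" if "f \<in> F" for f
        using that by (simp add: cell_def)
      then have "(\<sigma> f = 1 \<longleftrightarrow> f x > 0) \<and> (\<sigma> f = - 1 \<longleftrightarrow> f x < 0) \<and> (\<sigma> f = 0 \<longleftrightarrow> f x = 0)"
        if "f \<in> F" for f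
        using that by (simp add: sgn_1_pos sgn_1_neg sgn_zero_iff)
      then show "x \<in> {x. (\<forall>f\<in>?P. f x > 0) \<and> (\<forall>f\<in>?Z. f x = 0)}"
        by auto
    next
      fix x assume x: "x \<in> {x. (\<forall>f\<in>?P. f x > 0) \<and> (\<forall>f\<in>?Z. f x = 0)}"
      then have "(\<sigma> f = 1 \<longrightarrow> f x > 0) \<and> (\<sigma> f = - 1 \<longrightarrow> - f x > 0) \<and> (\<sigma> f = 0 \<longrightarrow> f x = 0)"
        if "f \<in> F" for f
        using that by (simp add: ball_Un)
      then have "sgn (f x) = \<sigma> f" if "f \<in> F" for f
        using \<sigma>[OF that] that by fastforce
      then show "x \<in> cell \<sigma>"
        by (simp add: cell_def)
    qed
  qed
  have "S = \<Union> (cell ` \<Sigma>)"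
  proof (intro set_eqI iffI)
    fix x assume "x \<in> S"
    then show "x \<in> \<Union> (cell ` \<Sigma>)"
      by (auto simp: cell_def \<Sigma>_def)
  next
    fix y assume "y \<in> \<Union> (cell ` \<Sigma>)"
    then obtain x where "x \<in> S" "\<And>f. f \<in> F \<Longrightarrow> sgn (f y) = sgn (f x)"
      by (auto simp: cell_def \<Sigma>_def)
    then show "y \<in> S"
      using F(3)[of x y] by (simp add: sgn_agree_def)
  qed
  then show ?thesis
    using \<open>finite \<Sigma>\<close> basic unfolding semialgebraic_def by (intro exI[of _ "cell ` \<Sigma>"]) auto
qed

section \<open>Projection along a line and along a span\<close>

lemma real_polynomial_function_along_line:
  fixes v :: "'a::real_normed_vector"
  assumes "real_polynomial_function f"
  shows "\<exists>P n. P \<in> poly_families n \<and> (\<forall>x t. poly (P x) t = f (x + t *\<^sub>R v))"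
  using assms
proof induction
  case (linear f)
  have f: "f (x + t *\<^sub>R v) = f x + t * f v" for x t
    using linear by (simp add: linear_add linear_cmul bounded_linear.linear)
  have "real_polynomial_function f"
    using linear by (rule real_polynomial_function.intros(1))
  then have "real_polynomial_function (\<lambda>x. coeff [:f x, f v:] i)" for i
    by (cases i rule: nat.exhaust; cases "i - 1") auto
  then have "(\<lambda>x. [:f x, f v:]) \<in> poly_families 2"
    by (intro poly_familiesI) (auto simp: coeff_pCons split: nat.splits)
  then show ?case
    by (intro exI[of _ "\<lambda>x. [:f x, f v:]"] exI[of _ 2]) (auto simp: f)
next
  case (const c)
  have "(\<lambda>x. [:c:]) \<in> poly_families 1"
    by (intro poly_familiesI) (auto simp: coeff_pCons split: nat.splits)
  then show ?case
    by (intro exI[of _ "\<lambda>x. [:c:]"] exI[of _ 1]) auto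
next
  case (add f g)
  then obtain P m Q n where PQ: "P \<in> poly_families m" "\<And>x t. poly (P x) t = f (x + t *\<^sub>R v)"
    "Q \<in> poly_families n" "\<And>x t. poly (Q x) t = g (x + t *\<^sub>R v)"
    by blast
  have "(\<lambda>x. P x + Q x) \<in> poly_families (max m n)"
    by (intro poly_familiesI) (auto simp: poly_familiesD[OF PQ(1)] poly_familiesD[OF PQ(3)])
  then show ?case
    using PQ by (intro exI[of _ "\<lambda>x. P x + Q x"] exI[of _ "max m n"]) auto
next
  case (mult f g)
  then obtain P m Q n where PQ: "P \<in> poly_families m" "\<And>x t. poly (P x) t = f (x + t *\<^sub>R v)"
    "Q \<in> poly_families n" "\<And>x t. poly (Q x) t = g (x + t *\<^sub>R v)"
    by blast
  have "(\<lambda>x. P x * Q x) \<in> poly_families (m + n)"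
  proof (rule poly_familiesI)
    show "real_polynomial_function (\<lambda>x. coeff (P x * Q x) i)" for i
      unfolding coeff_mult
      by (intro real_polynomial_function_sum real_polynomial_function.intros(4)
          poly_familiesD(1)[OF PQ(1)] poly_familiesD(1)[OF PQ(3)]) simp
    show "coeff (P x * Q x) i = 0" if "i \<ge> m + n" for x i
      unfolding coeff_mult
    proof (intro sum.neutral ballI)
      fix j assume "j \<in> {..i}"
      then have "j \<ge> m \<or> i - j \<ge> n"
        using that by auto
      then show "coeff (P x) j * coeff (Q x) (i - j) = 0"
        using poly_familiesD(2)[OF PQ(1)] poly_familiesD(2)[OF PQ(3)] by auto
    qed
  qed
  then show ?case
    using PQ by (intro exI[of _ "\<lambda>x. P x * Q x"] exI[of _ "m + n"]) auto
qed

text \<open>Along the line the defining polynomials become polynomials in \<open>t\<close> with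
  coefficients depending on \<open>x\<close>. When their signs over \<open>x\<close> and
  \<open>y\<close> are matched, a witness \<open>t\<close> over \<open>x\<close> is replaced by a
  point \<open>u\<close> of the corresponding cell over \<open>y\<close>.\<close>

lemma sign_definable_project_line:
  fixes v :: "'a::real_normed_vector"
  assumes "sign_definable S"
  shows "sign_definable {x. \<exists>t. x + t *\<^sub>R v \<in> S}"
proof -
  obtain F where F: "finite F" "\<And>f. f \<in> F \<Longrightarrow> real_polynomial_function f"
    "\<And>x y. sgn_agree F x y \<Longrightarrow> x \<in> S \<Longrightarrow> y \<in> S"
    using sign_definableE[OF assms] by blast
  have "\<forall>f\<in>F. \<exists>P n. P \<in> poly_families n \<and> (\<forall>x t. poly (P x) t = f (x + t *\<^sub>R v))"
    using real_polynomial_function_along_line F(2) by blast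
  then obtain P n where P: "\<And>f. f \<in> F \<Longrightarrow> P f \<in> poly_families (n f)"
    "\<And>f x t. f \<in> F \<Longrightarrow> poly (P f x) t = f (x + t *\<^sub>R v)"
    by metis
  define N where "N = Max (insert 0 (n ` F))"
  have N: "n f \<le> N" if "f \<in> F" for f
    using that F(1) by (simp add: N_def)
  have "P ` F \<subseteq> poly_families N"
    using P(1) poly_families_mono[OF N] by blast
  then have "signs_controlled (P ` F)"
    using F(1) by (intro signs_controlled_poly_families) auto
  then obtain G where G: "finite G" "\<And>f. f \<in> G \<Longrightarrow> real_polynomial_function f"
    "\<And>x y. sgn_agree G x y \<Longrightarrow> \<exists>\<rho>. sign_matching \<rho> ((\<lambda>P. (P x, P y)) ` P ` F)"
    unfolding signs_controlled_def by blast
  show ?thesis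
  proof (rule sign_definableI[OF G(1,2)])
    fix x y assume agree: "sgn_agree G x y" and "x \<in> {x. \<exists>t. x + t *\<^sub>R v \<in> S}"
    then obtain t where t: "x + t *\<^sub>R v \<in> S"
      by blast
    obtain \<rho> where \<rho>: "sign_matching \<rho> ((\<lambda>P. (P x, P y)) ` P ` F)"
      using G(3)[OF agree] by blast
    then obtain u where u: "same_side \<rho> t u"
      using same_side_exists[of \<rho> t] by (auto simp: sign_matching_def)
    have "sgn (f (x + t *\<^sub>R v)) = sgn (f (y + u *\<^sub>R v))" if "f \<in> F" for f
      using sign_matchingD[OF \<rho> _ u, of "P f x" "P f y"] that by (simp add: P(2))
    then have "y + u *\<^sub>R v \<in> S"
      using F(3)[OF _ t] by (simp add: sgn_agree_def)
    then show "y \<in> {x. \<exists>t. x + t *\<^sub>R v \<in> S}"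
      by blast
  qed auto
qed

lemma sign_definable_project_span:
  fixes B :: "'a::real_normed_vector set"
  assumes "finite B" "sign_definable S"
  shows "sign_definable {x. \<exists>w\<in>span B. x + w \<in> S}"
  using assms
proof (induction B)
  case (insert b B)
  have eq: "{x. \<exists>w\<in>span (insert b B). x + w \<in> S} = {x. \<exists>t. x + t *\<^sub>R b \<in> {x. \<exists>w\<in>span B. x + w \<in> S}}"
  proof (intro set_eqI iffI)
    fix x assume "x \<in> {x. \<exists>w\<in>span (insert b B). x + w \<in> S}"
    then obtain w k where "w - k *\<^sub>R b \<in> span B" "x + w \<in> S"
      by (auto simp: span_insert)
    then show "x \<in> {x. \<exists>t. x + t *\<^sub>R b \<in> {x. \<exists>w\<in>span B. x + w \<in> S}}"
      by (auto intro!: exI[of _ k] bexI[of _ "w - k *\<^sub>R b"])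
  next
    fix x assume "x \<in> {x. \<exists>t. x + t *\<^sub>R b \<in> {x. \<exists>w\<in>span B. x + w \<in> S}}"
    then obtain t w where "w \<in> span B" "x + t *\<^sub>R b + w \<in> S"
      by auto
    then show "x \<in> {x. \<exists>w\<in>span (insert b B). x + w \<in> S}"
      by (auto simp: span_insert add.assoc intro!: exI[of _ "t *\<^sub>R b + w"] exI[of _ t])
  qed
  show ?case
    unfolding eq by (rule sign_definable_project_line[OF insert.IH[OF insert.prems]])
qed simp

text \<open>A point \<open>x\<close> is in the projection if and only if some translate of
  \<open>(x, 0)\<close> along the second factor is in \<open>S\<close>. Projecting along that
  subspace and pulling back along the embedding of the first factor reduces the claim to
  \<open>sign_definable_project_span\<close>.\<close>

theorem tarski_seidenberg:
  fixes S :: "('a::euclidean_space \<times> 'b::euclidean_space) set"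
  assumes "semialgebraic S"
  shows "semialgebraic (fst ` S)"
proof -
  define B where "B = Pair (0::'a) ` (Basis :: 'b set)"
  have "span B = Pair 0 ` UNIV"
    unfolding B_def by (subst span_linear_image) (auto simp: linear_iff)
  then have eq: "fst ` S = (\<lambda>x. (x, 0)) -` {x. \<exists>w\<in>span B. x + w \<in> S}"
    by force
  have "bounded_linear (\<lambda>x::'a. (x, 0::'b))"
    by (intro bounded_linear_Pair bounded_linear_ident bounded_linear_zero)
  then have "sign_definable (fst ` S)"
    unfolding eq using semialgebraic_imp_sign_definable[OF assms]
    by (intro sign_definable_vimage sign_definable_project_span polynomial_function_bounded_linear)
      (auto simp: B_def)
  then show ?thesis
    by (rule sign_definable_imp_semialgebraic)
qed

section \<open>The coordinatewise exponential map\<close>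

text \<open>A class of functions closed under directional derivatives on \<open>S\<close> consists
  of smooth functions. Derivatives are known on \<open>S\<close> only, so the induction is about any
  \<open>h\<close> that agrees on \<open>S\<close> with a member of \<open>D\<close>.\<close>

lemma smooth_on_coinduct:
  assumes S: "open S" and f: "f \<in> D"
    and step: "\<And>f. f \<in> D \<Longrightarrow> \<exists>f'. (\<forall>x\<in>S. (f has_derivative f' x) (at x)) \<and> (\<forall>v. \<exists>g\<in>D. \<forall>x\<in>S. f' x v = g x)"
  shows "smooth_on S f"
proof -
  have "C_on n S h" if "\<exists>f\<in>D. \<forall>x\<in>S. h x = f x" for n h
    using that
  proof (induction n arbitrary: h)
    case 0
    then obtain f where "f \<in> D" and eq: "\<forall>x\<in>S. h x = f x"
      by blast
    then have "continuous_on S f"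
      using step[OF \<open>f \<in> D\<close>] by (metis continuous_at_imp_continuous_on has_derivative_continuous)
    then show ?case
      using eq by (simp cong: continuous_on_cong)
  next
    case (Suc n)
    then obtain f where "f \<in> D" and eq: "\<forall>x\<in>S. h x = f x"
      by blast
    obtain f' where f': "\<And>x. x \<in> S \<Longrightarrow> (f has_derivative f' x) (at x)"
      and g: "\<And>v. \<exists>g\<in>D. \<forall>x\<in>S. f' x v = g x"
      using step[OF \<open>f \<in> D\<close>] by blast
    have h': "(h has_derivative f' x) (at x)" if "x \<in> S" for x
      using has_derivative_transform_within_open[OF f'[OF that] S that] eq by simp
    then have "frechet_derivative h (at x) = f' x" if "x \<in> S" for x
      using frechet_derivative_at[of h "f' x"] that by metis
    then have "C_on n S (\<lambda>x. frechet_derivative h (at x) v)" for v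
      using g[of v] by (intro Suc.IH) auto
    then show ?case
      using h' by (auto simp: differentiable_def)
  qed
  then show ?thesis
    using f by (auto simp: smooth_on_def)
qed

lemma has_derivative_componentwise_real:
  fixes f :: "'k::finite \<Rightarrow> real \<Rightarrow> real"
  assumes "\<And>i. (f i has_real_derivative f' i) (at (x $ i))"
  shows "((\<lambda>x. \<chi> i. f i (x $ i)) has_derivative (\<lambda>v. \<chi> i. f' i * v $ i)) (at x)"
proof -
  have "((\<lambda>x. f i (x $ i)) has_derivative (\<lambda>v. f' i * v $ i)) (at x)" for i
    by (rule has_derivative_compose[OF bounded_linear_imp_has_derivative[OF bounded_linear_vec_nth]
          assms[of i, unfolded has_field_derivative_def]])
  then show ?thesis
    by (subst has_derivative_componentwise_within)
      (auto simp: Basis_vec_def inner_axis)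
qed

lemma diffeomorphism_exp:
  "diffeomorphism UNIV {y :: real ^ 'k::finite. \<forall>i. y $ i > 0} (\<lambda>x. \<chi> i. exp (x $ i))"
    (is "diffeomorphism UNIV ?V ?g")
proof -
  have "open ?V"
    unfolding Collect_all_eq by (intro open_INT ballI open_Collect_less continuous_intros) auto
  have inj: "inj ?g"
    by (auto simp: inj_def vec_eq_iff)
  have ln: "?g (\<chi> i. ln (y $ i)) = y" if "y \<in> ?V" for y
    using that by (auto simp: vec_eq_iff)
  have bij: "bij_betw ?g UNIV ?V"
    unfolding bij_betw_def
  proof (intro conjI inj set_eqI iffI)
    show "y \<in> range ?g" if "y \<in> ?V" for y
      using ln[OF that] by (metis rangeI)
  qed auto
  have inv: "inv ?g y = (\<chi> i. ln (y $ i))" if "y \<in> ?V" for y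
    using inv_f_f[OF inj, of "\<chi> i. ln (y $ i)"] ln[OF that] by simp
  have "smooth_on UNIV ?g"
  proof (rule smooth_on_coinduct)
    \<comment> \<open>Closed under directional derivatives, as the direction is absorbed into
      \<open>c\<close>.\<close>
    let ?D = "range (\<lambda>c (x::real^'k). \<chi> i. c i * exp (x $ i))"
    show "?g \<in> ?D"
      by (rule image_eqI[of _ _ "\<lambda>_. 1"]) auto
    show "\<exists>f'. (\<forall>x\<in>UNIV. (f has_derivative f' x) (at x)) \<and> (\<forall>v. \<exists>g\<in>?D. \<forall>x\<in>UNIV. f' x v = g x)"
      if "f \<in> ?D" for f
    proof -
      obtain c where f: "f = (\<lambda>x. \<chi> i. c i * exp (x $ i))"
        using \<open>f \<in> ?D\<close> by blast
      let ?f' = "\<lambda>x v. \<chi> i. c i * exp (x $ i) * v $ i"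
      have "(f has_derivative ?f' x) (at x)" for x
        unfolding f by (rule has_derivative_componentwise_real) (auto intro!: derivative_eq_intros)
      moreover have "(\<lambda>x. ?f' x v) \<in> ?D" for v
        by (rule image_eqI[of _ _ "\<lambda>i. c i * v $ i"]) (auto simp: fun_eq_iff mult_ac)
      then have "\<exists>g\<in>?D. \<forall>x\<in>UNIV. ?f' x v = g x" for v
        by (intro bexI[of _ "\<lambda>x. ?f' x v"]) simp_all
      ultimately show ?thesis
        by (intro exI[of _ ?f'] conjI ballI allI) auto
    qed
  qed simp
  moreover have "smooth_on ?V (inv ?g)"
  proof (rule smooth_on_coinduct)
    \<comment> \<open>These are the derivatives of the coordinatewise logarithm up to constants. The
      class is completed by \<open>inv ?g\<close> itself, which is known to be that logarithm only
      on the orthant.\<close>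
    let ?R = "(\<lambda>(c, k) (x::real^'k). \<chi> i. c i / (x $ i) ^ Suc k) ` UNIV"
    let ?D = "insert (inv ?g) ?R"
    show "\<exists>f'. (\<forall>x\<in>?V. (f has_derivative f' x) (at x)) \<and> (\<forall>v. \<exists>g\<in>?D. \<forall>x\<in>?V. f' x v = g x)"
      if "f \<in> ?D" for f
    proof (cases "f = inv ?g")
      case True
      let ?f' = "\<lambda>x v. \<chi> i. 1 / (x $ i) * v $ i"
      have "(f has_derivative ?f' x) (at x)" if "x \<in> ?V" for x
      proof (rule has_derivative_transform_within_open[OF _ \<open>open ?V\<close> that])
        show "((\<lambda>x. \<chi> i. ln (x $ i)) has_derivative ?f' x) (at x)"
          using that by (intro has_derivative_componentwise_real) (auto intro!: derivative_eq_intros)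
        show "(\<chi> i. ln (x $ i)) = f x" if "x \<in> ?V" for x
          using inv[OF that] True by simp
      qed
      moreover have "(\<lambda>x. ?f' x v) \<in> ?D" for v
        by (rule insertI2, rule image_eqI[of _ _ "(\<lambda>i. v $ i, 0)"]) auto
      then have "\<exists>g\<in>?D. \<forall>x\<in>?V. ?f' x v = g x" for v
        by (intro bexI[of _ "\<lambda>x. ?f' x v"]) simp_all
      ultimately show ?thesis
        by (intro exI[of _ ?f'] conjI ballI allI) auto
    next
      case False
      then obtain c k where f: "f = (\<lambda>x. \<chi> i. c i / (x $ i) ^ Suc k)"
        using \<open>f \<in> ?D\<close> by auto
      let ?f' = "\<lambda>x v. \<chi> i. (- c i * real (Suc k) / (x $ i) ^ Suc (Suc k)) * v $ i"
      have "(f has_derivative ?f' x) (at x)" if "x \<in> ?V" for x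
        unfolding f
      proof (rule has_derivative_componentwise_real)
        fix i
        have "x $ i \<noteq> 0"
          using that by (metis (mono_tags) less_irrefl mem_Collect_eq)
        then show "((\<lambda>t. c i / t ^ Suc k) has_real_derivative - c i * real (Suc k) / (x $ i) ^ Suc (Suc k)) (at (x $ i))"
          by (auto intro!: derivative_eq_intros simp: field_simps) (metis Suc_pred power_Suc)
      qed
      moreover have "(\<lambda>x. ?f' x v) \<in> ?D" for v
        by (rule insertI2, rule image_eqI[of _ _ "(\<lambda>i. - c i * real (Suc k) * v $ i, Suc k)"])
          (auto simp: fun_eq_iff vec_eq_iff)
      then have "\<exists>g\<in>?D. \<forall>x\<in>?V. ?f' x v = g x" for v
        by (intro bexI[of _ "\<lambda>x. ?f' x v"]) simp_all
      ultimately show ?thesis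
        by (intro exI[of _ ?f'] conjI ballI allI) auto
    qed
  qed (use \<open>open ?V\<close> in auto)
  ultimately show ?thesis
    using \<open>open ?V\<close> bij by (simp add: diffeomorphism_def)
qed

section \<open>Discrete exponential families\<close>

lemma restrict_eq_iff: "restrict a A = restrict b A \<longleftrightarrow> (\<forall>x\<in>A. a x = b x)"
  by (auto simp: restrict_def fun_eq_iff)

locale discrete_exponential_family =
  fixes m :: nat and e :: "'k::finite \<Rightarrow> nat"
  assumes e: "bij_betw e UNIV {1..m - 1}"
begin

declare One_nat_def [simp del] \<comment> \<open>keeps \<open>{1..m}\<close> from being rewritten to \<open>{Suc 0..m}\<close>\<close>

abbreviation "ref \<equiv> count_space {1..m}"
abbreviation "stat \<equiv> (discrete_stat e :: nat \<Rightarrow> real ^ 'k)"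
abbreviation "P \<eta> \<equiv> exp_family ref stat \<eta>"

definition normalizer :: "real ^ 'k \<Rightarrow> real" where
  "normalizer \<eta> = 1 + (\<Sum>i\<in>UNIV. exp (\<eta> $ i))"

lemma inj_e: "inj e" and range_e: "range e = {1..m - 1}"
  using e by (auto simp: bij_betw_def)

text \<open>The index type is nonempty, hence so is \<open>{1..m - 1}\<close>.\<close>

lemma m_ge_2: "m \<ge> 2"
  using range_e by (cases "m \<ge> 2") (auto dest: equalityD1)

lemma categories: "{1..m} = insert m (range e)" "m \<notin> range e"
  using m_ge_2 unfolding range_e by auto

lemma inner_stat: "\<eta> \<bullet> stat (e i) = \<eta> $ i" "\<eta> \<bullet> stat m = 0"
proof -
  have "\<eta> \<bullet> stat (e i) = (\<Sum>j\<in>UNIV. if j = i then \<eta> $ j else 0)"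
    unfolding inner_vec_def discrete_stat_def
    by (intro sum.cong) (auto simp: indicator_def dest: injD[OF inj_e])
  then show "\<eta> \<bullet> stat (e i) = \<eta> $ i"
    by simp
  show "\<eta> \<bullet> stat m = 0"
    using categories(2) by (auto simp: inner_vec_def discrete_stat_def indicator_def intro!: sum.neutral)
qed

lemma sum_exp: "(\<Sum>x\<in>{1..m}. exp (\<eta> \<bullet> stat x)) = normalizer \<eta>"
  unfolding categories(1) using categories(2)
  by (simp add: sum.reindex[OF inj_e] inner_stat normalizer_def)

lemma normalizer_pos: "normalizer \<eta> > 0"
  by (auto simp: normalizer_def intro!: add_pos_nonneg sum_nonneg)

lemma family_eq: "P \<eta> = point_measure {1..m} (\<lambda>x. exp (\<eta> \<bullet> stat x) / normalizer \<eta>)"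
proof -
  have "log_partition ref stat \<eta> = ln (normalizer \<eta>)"
    by (simp add: log_partition_def lebesgue_integral_count_space_finite sum_exp)
  then show ?thesis
    using normalizer_pos[of \<eta>] by (simp add: exp_family_def point_measure_def exp_diff)
qed

lemma emeasure_family:
  "x \<in> {1..m} \<Longrightarrow> emeasure (P \<eta>) {x} = ennreal (exp (\<eta> \<bullet> stat x) / normalizer \<eta>)"
  unfolding family_eq by (subst emeasure_point_measure_finite) auto

lemma sets_family: "sets (P \<eta>) = Pow {1..m}" and space_family: "space (P \<eta>) = {1..m}"
  by (simp_all add: family_eq sets_point_measure space_point_measure)

lemma prob_vector_family:
  "prob_vector m (P \<eta>) = (\<lambda>x\<in>{1..m}. exp (\<eta> \<bullet> stat x) / normalizer \<eta>)"
  unfolding prob_vector_def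
  using normalizer_pos[of \<eta>] by (intro restrict_ext) (simp add: measure_def emeasure_family)

lemma prob_space_family: "prob_space (P \<eta>)"
proof
  have "emeasure (P \<eta>) (space (P \<eta>)) = (\<Sum>x\<in>{1..m}. ennreal (exp (\<eta> \<bullet> stat x) / normalizer \<eta>))"
    unfolding space_family unfolding family_eq by (subst emeasure_point_measure_finite) auto
  also have "\<dots> = ennreal (\<Sum>x\<in>{1..m}. exp (\<eta> \<bullet> stat x) / normalizer \<eta>)"
    using normalizer_pos[of \<eta>] by (intro sum_ennreal) auto
  also have "\<dots> = 1"
    using normalizer_pos[of \<eta>] by (simp add: sum_exp flip: sum_divide_distrib)
  finally show "emeasure (P \<eta>) (space (P \<eta>)) = 1" .
qed

lemma prob_vector_in_simplex: "prob_vector m (P \<eta>) \<in> open_simplex m"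
proof -
  have "(\<Sum>x\<in>{1..m}. prob_vector m (P \<eta>) x) = 1"
    using normalizer_pos[of \<eta>] by (simp add: prob_vector_family sum_exp flip: sum_divide_distrib)
  then show ?thesis
    using normalizer_pos[of \<eta>] unfolding open_simplex_def prob_vector_family by auto
qed

text \<open>With \<open>m\<close> as reference category the unnormalized weights are
  \<open>p x / p m\<close>. Their sum is \<open>1 / p m\<close>, so normalizing gives back
  \<open>p\<close>.\<close>

lemma log_odds:
  assumes p: "p \<in> open_simplex m"
  defines "\<eta> \<equiv> (\<chi> i. ln (p (e i) / p m))"
  shows "prob_vector m (P \<eta>) = p"
proof -
  have pos: "p x > 0" if "x \<in> {1..m}" for x
    using p that by (simp add: open_simplex_def)
  then have pm: "p m > 0"
    using m_ge_2 by auto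
  have eq: "exp (\<eta> \<bullet> stat x) = p x / p m" if x: "x \<in> {1..m}" for x
  proof (cases "x = m")
    case True
    then show ?thesis
      using pm by (simp add: inner_stat)
  next
    case False
    then obtain i where "x = e i"
      using x categories by auto
    then show ?thesis
      using pm pos[OF x] by (simp add: inner_stat \<eta>_def)
  qed
  have "normalizer \<eta> = (\<Sum>x\<in>{1..m}. p x / p m)"
    unfolding sum_exp[symmetric] by (intro sum.cong refl eq)
  also have "\<dots> = 1 / p m"
    using p by (simp add: open_simplex_def flip: sum_divide_distrib)
  finally have "exp (\<eta> \<bullet> stat x) / normalizer \<eta> = p x" if "x \<in> {1..m}" for x
    using eq[OF that] pm by simp
  then show ?thesis
    using p unfolding prob_vector_family open_simplex_def
    by (intro extensionalityI[of _ "{1..m}"]) (auto simp: PiE_def)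
qed

lemma family_image:
  assumes Q: "Q \<subseteq> open_simplex m"
  shows "exp_family ref stat ` {\<eta>. prob_vector m (P \<eta>) \<in> Q} = discrete_model m Q"
proof (intro set_eqI iffI)
  fix \<mu> assume "\<mu> \<in> exp_family ref stat ` {\<eta>. prob_vector m (P \<eta>) \<in> Q}"
  then obtain \<eta> where "\<mu> = P \<eta>" "prob_vector m (P \<eta>) \<in> Q"
    by blast
  then show "\<mu> \<in> discrete_model m Q"
    by (simp add: discrete_model_def prob_space_family space_family sets_family)
next
  fix \<mu> assume \<mu>: "\<mu> \<in> discrete_model m Q"
  then interpret \<mu>: prob_space \<mu>
    by (simp add: discrete_model_def)
  obtain \<eta> where \<eta>: "prob_vector m (P \<eta>) = prob_vector m \<mu>"
    using log_odds \<mu> Q by (auto simp: discrete_model_def)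
  interpret P: prob_space "P \<eta>"
    by (rule prob_space_family)
  \<comment> \<open>A measure on a finite set is determined by its point masses, which
    \<open>prob_vector\<close> records.\<close>
  have "\<mu> = P \<eta>"
  proof (rule measure_eqI_finite)
    show "sets \<mu> = Pow {1..m}"
      using \<mu> by (simp add: discrete_model_def)
    show "emeasure \<mu> {x} = emeasure (P \<eta>) {x}" if "x \<in> {1..m}" for x
      using fun_cong[OF \<eta>, of x] that
      by (simp add: prob_vector_def \<mu>.emeasure_eq_measure P.emeasure_eq_measure)
  qed (auto simp: sets_family)
  moreover have "prob_vector m (P \<eta>) \<in> Q"
    using \<eta> \<mu> by (simp add: discrete_model_def)
  ultimately show "\<mu> \<in> exp_family ref stat ` {\<eta>. prob_vector m (P \<eta>) \<in> Q}"
    by blast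
qed

lemma natural_parameters_eq: "natural_parameters ref stat = UNIV"
  by (auto simp: natural_parameters_def nn_integral_count_space_finite less_top)

text \<open>Every \<open>stat x\<close> is in the support, since a neighbourhood has at least the
  mass of \<open>{x}\<close>. These points are the origin and the coordinate unit vectors, whose
  affine hull is the whole space.\<close>

lemma regular_family: "regular_exponential_family ref stat"
proof -
  have meas: "stat \<in> borel_measurable ref"
    by simp
  have "stat x \<in> measure_support (distr ref borel stat)" if x: "x \<in> {1..m}" for x
    unfolding measure_support_def
  proof (intro CollectI allI impI)
    fix U :: "(real ^ 'k) set" assume U: "open U \<and> stat x \<in> U"
    then have "emeasure (distr ref borel stat) U = emeasure ref (stat -` U \<inter> {1..m})"
      by (subst emeasure_distr[OF meas]) auto
    also have "\<dots> \<ge> emeasure ref {x}"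
      using x U by (intro emeasure_mono) auto
    finally show "emeasure (distr ref borel stat) U > 0"
      using x by (simp add: emeasure_count_space less_le_trans[OF zero_less_one])
  qed
  note supp = this
  have 0: "stat m = 0"
    using categories(2) by (auto simp: discrete_stat_def vec_eq_iff indicator_def)
  have axis: "stat (e i) = axis i 1" for i
    by (auto simp: discrete_stat_def vec_eq_iff indicator_def axis_def dest: injD[OF inj_e])
  have "m \<in> {1..m}" "e i \<in> {1..m}" for i
    unfolding categories by auto
  then have "0 \<in> measure_support (distr ref borel stat)"
    "axis i 1 \<in> measure_support (distr ref borel stat)" for i
    using supp 0 axis by metis+
  then have sub: "insert 0 Basis \<subseteq> measure_support (distr ref borel stat)"
    by (auto simp: Basis_vec_def)
  have "UNIV = affine hull (insert 0 (Basis :: (real ^ 'k) set))"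
    by (subst affine_hull_span_0) (auto simp: hull_inc)
  also have "\<dots> \<subseteq> affine hull (measure_support (distr ref borel stat))"
    by (rule hull_mono[OF sub])
  finally have "aff_dim (measure_support (distr ref borel stat)) = int DIM(real ^ 'k)"
    by (subst aff_dim_eq_full) auto
  moreover have "sigma_finite_measure ref"
    by (simp add: sigma_finite_measure_count_space_finite)
  ultimately show ?thesis
    using meas unfolding regular_exponential_family_def natural_parameters_eq by simp
qed

section \<open>Odds against the reference category \<open>m\<close>, and semi-algebraicity in these
  coordinates\<close>

definition odds :: "real ^ 'k \<Rightarrow> nat \<Rightarrow> real" where
  "odds q x = (if x = m then 1 else q $ inv e x)"

lemma odds_exp: "x \<in> {1..m} \<Longrightarrow> odds (\<chi> i. exp (\<eta> $ i)) x = exp (\<eta> \<bullet> stat x)"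
  unfolding categories(1) using categories(2) inj_e by (auto simp: odds_def inner_stat)

text \<open>The equations are polynomial in \<open>q\<close> and \<theta> jointly, and quantifying
  over \<theta> is a projection, so \<open>tarski_seidenberg\<close> applies.\<close>

lemma semialgebraic_rational_odds:
  fixes f g :: "nat \<Rightarrow> 'a::euclidean_space \<Rightarrow> real"
  assumes "semialgebraic \<Theta>"
    and f: "\<And>x. x \<in> {1..m} \<Longrightarrow> real_polynomial_function (f x)"
    and g: "\<And>x. x \<in> {1..m} \<Longrightarrow> real_polynomial_function (g x)"
  shows "semialgebraic
    {q. \<exists>\<theta>\<in>\<Theta>. \<forall>x\<in>{1..m}. f x \<theta> * (1 + (\<Sum>i\<in>UNIV. q $ i)) = odds q x * g x \<theta>}"
    (is "semialgebraic ?A")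
proof -
  define h where "h x = (\<lambda>z. f x (snd z) * (1 + (\<Sum>i\<in>UNIV. fst z $ i)) - odds (fst z) x * g x (snd z))" for x
  define S where "S = snd -` \<Theta> \<inter> {z. \<forall>k\<in>h ` {1..m}. k z = 0}"
  have coord: "real_polynomial_function (\<lambda>z :: (real ^ 'k) \<times> 'a. fst z $ i)" for i
    by (intro real_polynomial_function.intros(1) bounded_linear_compose[OF bounded_linear_vec_nth bounded_linear_fst])
  have snd: "polynomial_function (snd :: (real ^ 'k) \<times> 'a \<Rightarrow> 'a)"
    by (intro polynomial_function_bounded_linear bounded_linear_snd)
  have odds: "real_polynomial_function (\<lambda>z :: (real ^ 'k) \<times> 'a. odds (fst z) x)" for x
    using coord by (cases "x = m") (auto simp: odds_def)
  have "real_polynomial_function k" if "k \<in> h ` {1..m}" for k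
  proof -
    obtain x where x: "x \<in> {1..m}" "k = h x"
      using \<open>k \<in> h ` {1..m}\<close> by blast
    have "real_polynomial_function (\<lambda>z :: (real ^ 'k) \<times> 'a. f x (snd z))"
      "real_polynomial_function (\<lambda>z :: (real ^ 'k) \<times> 'a. g x (snd z))"
      using real_polynomial_function_compose[OF snd] f[OF x(1)] g[OF x(1)] by (simp_all add: o_def)
    then show ?thesis
      unfolding x(2) h_def using coord odds
      by (intro real_polynomial_function_diff real_polynomial_function.intros(2-4) real_polynomial_function_sum) auto
  qed
  then have "sign_definable S"
    unfolding S_def
    by (intro sign_definable_Int sign_definable_zeros sign_definable_vimage[OF snd]
        semialgebraic_imp_sign_definable assms) auto
  then have "semialgebraic (fst ` S)"
    by (intro tarski_seidenberg sign_definable_imp_semialgebraic)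
  also have "fst ` S = ?A"
  proof -
    have "(q, \<theta>) \<in> S \<longleftrightarrow> \<theta> \<in> \<Theta> \<and>
        (\<forall>x\<in>{1..m}. f x \<theta> * (1 + (\<Sum>i\<in>UNIV. q $ i)) = odds q x * g x \<theta>)" for q \<theta>
      by (simp add: S_def h_def)
    moreover have "fst ` S = {q. \<exists>\<theta>. (q, \<theta>) \<in> S}"
      by force
    ultimately show ?thesis
      by (simp add: Bex_def)
  qed
  finally show ?thesis .
qed

text \<open>Cross-multiplication is an equivalence, because the denominators do not vanish on
  \<Theta> and the normalizer is positive. The set \<open>?A\<close> may extend beyond the positive
  orthant; the intersection with the image of the diffeomorphism removes the excess.\<close>

lemma algebraic_subfamily:
  fixes f g :: "nat \<Rightarrow> 'a::euclidean_space \<Rightarrow> real"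
  assumes \<Theta>: "semialgebraic \<Theta>"
    and f: "\<And>x. x \<in> {1..m} \<Longrightarrow> real_polynomial_function (f x)"
    and g: "\<And>x. x \<in> {1..m} \<Longrightarrow> real_polynomial_function (g x)"
    and dom: "\<Theta> \<subseteq> rational_map_domain m g"
  shows "algebraic_exponential_family ref stat {\<eta>. prob_vector m (P \<eta>) \<in> rational_map m f g ` \<Theta>}"
    (is "algebraic_exponential_family _ _ ?M")
proof -
  let ?A = "{q. \<exists>\<theta>\<in>\<Theta>. \<forall>x\<in>{1..m}. f x \<theta> * (1 + (\<Sum>i\<in>UNIV. q $ i)) = odds q x * g x \<theta>}"
  let ?G = "\<lambda>\<eta> :: real ^ 'k. \<chi> i. exp (\<eta> $ i)"
  have "\<eta> \<in> ?M \<longleftrightarrow> ?G \<eta> \<in> ?A" for \<eta>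
  proof -
    have eq: "prob_vector m (P \<eta>) = rational_map m f g \<theta> \<longleftrightarrow>
        (\<forall>x\<in>{1..m}. f x \<theta> * (1 + (\<Sum>i\<in>UNIV. ?G \<eta> $ i)) = odds (?G \<eta>) x * g x \<theta>)"
      if "\<theta> \<in> \<Theta>" for \<theta>
    proof -
      have "g x \<theta> \<noteq> 0" if "x \<in> {1..m}" for x
        using dom \<open>\<theta> \<in> \<Theta>\<close> that by (auto simp: rational_map_domain_def)
      then have "exp (\<eta> \<bullet> stat x) / normalizer \<eta> = f x \<theta> / g x \<theta> \<longleftrightarrow>
          f x \<theta> * (1 + (\<Sum>i\<in>UNIV. ?G \<eta> $ i)) = odds (?G \<eta>) x * g x \<theta>" if "x \<in> {1..m}" for x
        using that normalizer_pos[of \<eta>] unfolding odds_exp[OF that] normalizer_def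
        by (auto simp: frac_eq_eq)
      then have "(\<forall>x\<in>{1..m}. exp (\<eta> \<bullet> stat x) / normalizer \<eta> = f x \<theta> / g x \<theta>) \<longleftrightarrow>
          (\<forall>x\<in>{1..m}. f x \<theta> * (1 + (\<Sum>i\<in>UNIV. ?G \<eta> $ i)) = odds (?G \<eta>) x * g x \<theta>)"
        by (rule ball_cong[OF refl])
      then show ?thesis
        unfolding prob_vector_family rational_map_def restrict_eq_iff .
    qed
    show ?thesis
      using eq by blast
  qed
  then have "?M = {\<eta> \<in> natural_parameters ref stat. ?G \<eta> \<in> ?A \<inter> {y. \<forall>i. y $ i > 0}}"
    by (auto simp: natural_parameters_eq)
  moreover have "diffeomorphism (natural_parameters ref stat) {y. \<forall>i. y $ i > 0} ?G"
    unfolding natural_parameters_eq by (rule diffeomorphism_exp)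
  moreover from this have "open {y :: real ^ 'k. \<forall>i. y $ i > 0}"
    by (simp add: diffeomorphism_def)
  moreover have "semialgebraic ?A"
    using \<Theta> f g by (rule semialgebraic_rational_odds)
  ultimately show ?thesis
    unfolding algebraic_exponential_family_def using regular_family natural_parameters_eq by blast
qed

end

text \<open>The first three conjuncts tie the parameters to distributions: the ambient family
  consists of all positive distributions, and \<open>M\<close> induces exactly the given model. Only
  then does the last conjunct speak about that model.\<close>

theorem corollary14:
  fixes m :: nat
    and e :: "'k::finite \<Rightarrow> nat"
    and \<Theta> :: "(real ^ 'd) set"
    and f g :: "nat \<Rightarrow> real ^ 'd \<Rightarrow> real"
    and \<psi> :: "real ^ 'd \<Rightarrow> nat \<Rightarrow> real"
    and \<nu> :: "nat measure"
    and T :: "nat \<Rightarrow> real ^ 'k"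
    and M :: "(real ^ 'k) set"
  assumes "m \<ge> 2"
    and "bij_betw e UNIV {1..m - 1}"
    and "semialgebraic \<Theta>"
    and "\<And>i. i \<in> {1..m} \<Longrightarrow> real_polynomial_function (f i)"
    and "\<And>i. i \<in> {1..m} \<Longrightarrow> real_polynomial_function (g i)"
    and "\<Theta> \<subseteq> rational_map_domain m g"
  defines "\<psi> \<equiv> rational_map m f g"
  assumes "\<psi> ` \<Theta> \<subseteq> open_simplex m"
  defines "\<nu> \<equiv> count_space {1..m}"
    and "T \<equiv> discrete_stat e"
    and "M \<equiv> {\<eta>. prob_vector m (exp_family \<nu> T \<eta>) \<in> \<psi> ` \<Theta>}"
  shows "natural_parameters \<nu> T = UNIV \<and>
         exp_family \<nu> T ` UNIV = discrete_model m (open_simplex m) \<and>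
         exp_family \<nu> T ` M = discrete_model m (\<psi> ` \<Theta>) \<and>
         algebraic_exponential_family \<nu> T M"
proof -
  interpret discrete_exponential_family m e
    by unfold_locales fact
  have "exp_family \<nu> T ` UNIV = discrete_model m (open_simplex m)"
    using family_image[of "open_simplex m"] prob_vector_in_simplex by (simp add: \<nu>_def T_def)
  moreover have "exp_family \<nu> T ` M = discrete_model m (\<psi> ` \<Theta>)"
    unfolding M_def \<nu>_def T_def by (rule family_image) fact
  moreover have "algebraic_exponential_family \<nu> T M"
    unfolding M_def \<nu>_def T_def \<psi>_def using assms(3-6) by (rule algebraic_subfamily)
  ultimately show ?thesis
    using natural_parameters_eq by (simp add: \<nu>_def T_def)
qed

end
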